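(* Let $\mathsf Z$ be any central charge and let $t\in\mathbb Q$. Then $\bar A_{\mathsf Z}=F_{\mathsf Z,t}*\bar A_*$, or equivalently, for all $\gamma\in S$, $$\bar A_{\mathsf Z}(\gamma)=\sum_{n\ge1}\ \sum_{\alpha\in S^n,\ \alpha_1+\dots+\alpha_n=\gamma}F_{\mathsf Z,t}(\alpha)\cdot\prod_{i=1}^n\bar A_*(\alpha_i)$$ (product taken in the order $i=1,\dots,n$), where $F_{\mathsf Z,t}:S^*\to\mathbb Q$ is the collection such that $F_{\mathsf Z,t}(\alpha)=1$ for $\alpha\in S$ and, for $\alpha\in S^n$ with $n\ge2$, $$F_{\mathsf Z,t}(\alpha)=\sum_T\Big[(-1)^{|V(T)|-1}\big(g_{\mathsf Z,t}(\alpha|_{\mathrm{ch}(v_0)})-g_{*,t}(\alpha|_{\mathrm{ch}(v_0)})\big)\prod_{v\in V(T)\setminus\{v_0\}}g_{*,t}(\alpha|_{\mathrm{ch}(v)})\Big],$$ the sum running over plane rooted trees $T$ with leaves $1,\dots,n$ (in this order) all of whose internal vertices have at least two children, and $v_0$ denoting the root of $T$.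
   Context: Setting. $S=\mathbb N^r\setminus\{0\}$, $\Gamma=\mathbb Z^r$, $S^*=\bigsqcup_{n\ge1}S^n$. $\mathcal R=\bigoplus_{\gamma\in\mathbb N^r}\mathcal R_\gamma$ is a graded associative (not necessarily commutative) $\mathbb Q$-algebra, and $\Gamma$ carries a skew-symmetric bilinear form $\langle-,-\rangle:\Gamma\times\Gamma\to\mathbb Z$ such that $\langle\gamma,\gamma'\rangle=0$ implies $[\mathcal R_\gamma,\mathcal R_{\gamma'}]=0$. Fix an arbitrary map $A:S\to\mathcal R$ with $A(\gamma)\in\mathcal R_\gamma$. A collection is a map $F:S^*\to\mathbb Q$. It acts on maps $H:S\to\mathcal R$ with $H(\gamma)\in\mathcal R_\gamma$ by $(F*H)(\gamma)=\sum_{n\ge1}\sum_{\alpha\in S^n,\,\alpha_1+\dots+\alpha_n=\gamma}F(\alpha)H(\alpha_1)\cdots H(\alpha_n)$. Central charges. A central charge is a linear map $\mathsf Z=-\theta+\mathbf i\rho:\mathbb Z^r\to\mathbb C$ with $\theta,\rho\in\mathrm{Hom}(\mathbb Z^r,\mathbb R)\cong\mathbb R^r$ and $\rho_k>0$ for all $k$. For $a\in S$ put $\mu_{\mathsf Z}(a)=\theta(a)/\rho(a)$; write $a\le_{\mathsf Z}b$ if $\mu_{\mathsf Z}(a)\le\mu_{\mathsf Z}(b)$, and $>_{\mathsf Z},<_{\mathsf Z},\sim_{\mathsf Z}$ for strict inequalities and equality of slopes. For $\theta\in\mathbb R^r$ alone, the subscript $\theta$ means that one uses $\mathsf Z=-\theta+\mathbf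 i\rho$ with $\rho=(1,\dots,1)$. $\mathsf Z$ is generic if $a\sim_{\mathsf Z}b$ (for $a,b\in S$) implies that $a,b$ are proportional. Invariants. The family $A_{\mathsf Z}(\gamma)\in\mathcal R_\gamma$, $\gamma\in S$, is determined recursively by $A(\gamma)=\sum_{\alpha_1+\dots+\alpha_n=\gamma,\ \alpha_1>_{\mathsf Z}\dots>_{\mathsf Z}\alpha_n}A_{\mathsf Z}(\alpha_1)\cdots A_{\mathsf Z}(\alpha_n)$ for all $\gamma\in S$. Then $\bar A_{\mathsf Z}=\mathbf{log}_{\mathsf Z}*A_{\mathsf Z}$, where $\mathbf{log}_{\mathsf Z}(\alpha)=\frac{(-1)^{n-1}}n$ if $\alpha\in S^n$ satisfies $\alpha_1\sim_{\mathsf Z}\dots\sim_{\mathsf Z}\alpha_n$, and $0$ otherwise. The attractor invariants are $\bar A_*(\gamma)=\bar A_{\theta'}(\gamma)$, where $\theta'$ is a generic perturbation of $\theta=\langle-,\gamma\rangle$, i.e. a generic stability parameter $\theta'\in\mathbb R^r$ sufficiently close to $\theta$ (how close depends on $\gamma$; the value does not depend on the choice). Collections $g_{\mathsf Z,t}$ and $g_{*,t}$. For $\alpha\in S^n$ and $1\le k<n$ put $\alpha_{\le k}=\alpha_1+\dots+\alpha_k$, $\alpha_{>k}=\alpha_{k+1}+\dots+\alpha_n$. Then $$g_{\mathsf Z,t}(\alpha)=t^{n_-}(t-1)^{n_+}\,\frac{t^{n_0+1}-(t-1)^{n_0+1}}{n_0+1},$$ where $n_+$ (respectively $n_-$, $n_0$)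 is the number of $1\le k<n$ with $\alpha_{\le k}>_{\mathsf Z}\alpha_{>k}$ (respectively $<_{\mathsf Z}$, $\sim_{\mathsf Z}$). The collection $g_{*,t}$ is given by the same formula, where now $n_+$ (respectively $n_-$, $n_0$) is the number of $1\le k<n$ with $\langle\alpha_{\le k},\alpha_{>k}\rangle>0$ (respectively $<0$, $=0$). Here $0^0=1$. Trees. In a plane rooted tree the children of each internal vertex are linearly ordered, which induces a linear order on the leaves; trees are taken up to isomorphism and the leaves are identified with $1<\dots<n$ in this order. $V(T)$ is the set of internal (non-leaf) vertices, including the root; $\mathrm{ch}(v)$ is the ordered set of children of $v$. For a vertex or leaf $u$ put $\alpha_u=\sum_i\alpha_i$, summed over the leaves $i$ that are descendants of (or equal to) $u$, and $\alpha|_{\mathrm{ch}(v)}=(\alpha_u)_{u\in\mathrm{ch}(v)}$, viewed as an element of $S^*$. *)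

theory Defs
  imports "HOL-Analysis.Finite_Cartesian_Product"
begin

section \<open>Dimension vectors and sequences of dimension vectors\<close>

text \<open>The lattice \<open>\<int>\<^sup>r\<close> is \<open>int ^ 'r\<close> with \<open>r = CARD('r)\<close>. The monoid \<open>\<nat>\<^sup>r\<close> and the set \<open>S = \<nat>\<^sup>r - {0}\<close>
  are subsets of it; maps defined on \<open>S\<close> are total functions whose values outside \<open>S\<close> are irrelevant.\<close>

definition NN :: "(int ^ 'r) set" where
  "NN = {\<gamma>. \<forall>i. 0 \<le> \<gamma> $ i}"

definition SS :: "(int ^ 'r) set" where
  "SS = NN - {0}"

definition decomps :: "int ^ 'r \<Rightarrow> (int ^ 'r) list set" where
  "decomps \<gamma> = {\<alpha>. \<alpha> \<noteq> [] \<and> set \<alpha> \<subseteq> SS \<and> sum_list \<alpha> = \<gamma>}"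

definition total :: "int ^ 'r \<Rightarrow> nat" where
  "total \<gamma> = nat (\<Sum>i\<in>UNIV. \<gamma> $ i)"

lemma total_add: "a \<in> NN \<Longrightarrow> b \<in> NN \<Longrightarrow> total (a + b) = total a + total b"
  by (simp add: total_def NN_def sum.distrib nat_add_distrib sum_nonneg)

lemma NN_add: "a \<in> NN \<Longrightarrow> b \<in> NN \<Longrightarrow> a + b \<in> NN"
  by (simp add: NN_def)

lemma total_pos: "a \<in> SS \<Longrightarrow> 0 < total a"
proof -
  assume a: "a \<in> SS"
  then obtain i where "a $ i \<noteq> 0"
    by (auto simp: SS_def vec_eq_iff)
  with a have "0 < a $ i"
    by (auto simp: SS_def NN_def order_less_le)
  with a have "0 < (\<Sum>i\<in>UNIV. a $ i)"
    by (intro sum_pos2[of _ i]) (auto simp: SS_def NN_def)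
  then show ?thesis
    by (simp add: total_def)
qed

lemma total_sum_list:
  "set \<alpha> \<subseteq> SS \<Longrightarrow> sum_list \<alpha> \<in> NN \<and> total (sum_list \<alpha>) = sum_list (map total \<alpha>)"
proof (induction \<alpha>)
  case Nil
  then show ?case by (simp add: NN_def total_def)
next
  case (Cons a \<alpha>)
  then show ?case by (auto simp: total_add NN_add SS_def)
qed

lemma total_decomps_less:
  assumes "\<alpha> \<in> decomps \<gamma>" "2 \<le> length \<alpha>" "a \<in> set \<alpha>"
  shows "total a < total \<gamma>"
proof -
  obtain xs ys where \<alpha>: "\<alpha> = xs @ a # ys"
    using assms(3) by (meson split_list)
  have S: "set \<alpha> \<subseteq> SS" "sum_list \<alpha> = \<gamma>"
    using assms(1) by (auto simp: decomps_def)
  have "xs @ ys \<noteq> []"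
    using assms(2) \<alpha> by auto
  then obtain b zs where b: "xs @ ys = b # zs"
    by (cases "xs @ ys") auto
  have "set (xs @ ys) \<subseteq> SS"
    using S(1) \<alpha> by auto
  then have "b \<in> SS"
    unfolding b by simp
  then have "0 < sum_list (map total (xs @ ys))"
    unfolding b using total_pos[of b] by simp
  then show ?thesis
    using total_sum_list[OF S(1)] S(2) \<alpha> by auto
qed

lemma finite_decomps: "finite (decomps (\<gamma> :: int ^ 'r))"
proof (cases "\<gamma> \<in> NN")
  case False
  then have "decomps \<gamma> = {}"
    using total_sum_list by (fastforce simp: decomps_def)
  then show ?thesis by simp
next
  case True
  let ?B = "{a :: int ^ 'r. \<forall>i. a $ i \<in> {0..int (total \<gamma>)}}"
  have "?B \<subseteq> (\<lambda>f. \<chi> i. f i) ` (UNIV \<rightarrow>\<^sub>E {0..int (total \<gamma>)})"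
  proof
    fix a assume "a \<in> ?B"
    then show "a \<in> (\<lambda>f. \<chi> i. f i) ` (UNIV \<rightarrow>\<^sub>E {0..int (total \<gamma>)})"
      by (intro image_eqI[where x = "\<lambda>i. a $ i"]) (auto simp: vec_eq_iff)
  qed
  then have fin: "finite ?B"
    by (rule finite_subset) (intro finite_imageI finite_PiE; simp)
  have "decomps \<gamma> \<subseteq> {\<alpha>. set \<alpha> \<subseteq> ?B \<and> length \<alpha> \<le> total \<gamma>}"
  proof
    fix \<alpha> assume "\<alpha> \<in> decomps \<gamma>"
    then have S: "set \<alpha> \<subseteq> SS" and tot: "total \<gamma> = sum_list (map total \<alpha>)"
      using total_sum_list by (auto simp: decomps_def)
    have "length \<alpha> \<le> sum_list (map total \<alpha>)"
      using S
    proof (induction \<alpha>)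
      case (Cons a \<alpha>)
      then show ?case using total_pos[of a] by auto
    qed simp
    moreover have "a \<in> ?B" if "a \<in> set \<alpha>" for a
    proof -
      have a: "a \<in> NN" using that S by (auto simp: SS_def)
      have "total a \<le> total \<gamma>"
        using that tot by (simp add: member_le_sum_list)
      moreover have "a $ i \<le> int (total a)" for i
        using a member_le_sum[of i UNIV "\<lambda>i. a $ i"] by (simp add: total_def NN_def sum_nonneg)
      ultimately show ?thesis
        using a by (auto simp: NN_def) (meson of_nat_mono order_trans)
    qed
    ultimately show "\<alpha> \<in> {\<alpha>. set \<alpha> \<subseteq> ?B \<and> length \<alpha> \<le> total \<gamma>}"
      using tot by auto
  qed
  then show ?thesis
    using finite_lists_length_le[OF fin] finite_subset by blast
qed


section \<open>The graded algebra and the skew-symmetric form\<close>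

text \<open>The last assumption says that the algebra is the internal direct sum of the \<open>R \<gamma>\<close>, \<open>\<gamma> \<in> \<nat>\<^sup>r\<close>:
  \<open>c \<gamma>\<close> is the homogeneous component of degree \<open>\<gamma>\<close> of \<open>x\<close>.\<close>

locale graded_rat_algebra = vector_space smul
  for smul :: "rat \<Rightarrow> 'a :: ring_1 \<Rightarrow> 'a" +
  fixes R :: "int ^ 'r \<Rightarrow> 'a set"
  assumes smul_mult_left: "smul q x * y = smul q (x * y)"
    and smul_mult_right: "x * smul q y = smul q (x * y)"
    and subspace_component: "\<gamma> \<in> NN \<Longrightarrow> subspace (R \<gamma>)"
    and one_component: "1 \<in> R 0"
    and mult_component: "\<gamma> \<in> NN \<Longrightarrow> \<delta> \<in> NN \<Longrightarrow> x \<in> R \<gamma> \<Longrightarrow> y \<in> R \<delta> \<Longrightarrow> x * y \<in> R (\<gamma> + \<delta>)"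
    and direct_sum: "\<exists>!c. (\<forall>\<gamma>\<in>NN. c \<gamma> \<in> R \<gamma>) \<and> (\<forall>\<gamma>. \<gamma> \<notin> NN \<longrightarrow> c \<gamma> = 0)
                       \<and> finite {\<gamma>. c \<gamma> \<noteq> 0} \<and> x = (\<Sum>\<gamma> | c \<gamma> \<noteq> 0. c \<gamma>)"

definition skew_form :: "(int ^ 'r \<Rightarrow> int ^ 'r \<Rightarrow> int) \<Rightarrow> bool" where
  "skew_form B \<longleftrightarrow> (\<forall>y. additive (\<lambda>x. B x y)) \<and> (\<forall>x. additive (B x)) \<and> (\<forall>x y. B x y = - B y x)"


section \<open>Central charges\<close>

definition central_charge :: "(int ^ 'r \<Rightarrow> complex) \<Rightarrow> bool" where
  "central_charge Z \<longleftrightarrow> additive Z \<and> (\<forall>k. 0 < Im (Z (axis k 1)))"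

text \<open>With \<open>Z = -\<theta> + \<i>\<rho>\<close> one has \<open>\<theta> = - Re Z\<close> and \<open>\<rho> = Im Z\<close>.\<close>

definition slope :: "(int ^ 'r \<Rightarrow> complex) \<Rightarrow> int ^ 'r \<Rightarrow> real" where
  "slope Z a = - Re (Z a) / Im (Z a)"

definition charge_of :: "real ^ 'r \<Rightarrow> int ^ 'r \<Rightarrow> complex" where
  "charge_of \<theta> a = Complex (- (\<Sum>i\<in>UNIV. \<theta> $ i * real_of_int (a $ i))) (\<Sum>i\<in>UNIV. real_of_int (a $ i))"

definition generic :: "(int ^ 'r \<Rightarrow> complex) \<Rightarrow> bool" where
  "generic Z \<longleftrightarrow> (\<forall>a\<in>SS. \<forall>b\<in>SS. slope Z a = slope Z b \<longrightarrow>
     (\<exists>q :: rat. \<forall>i. of_int (a $ i) = q * of_int (b $ i)))"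


section \<open>Collections and invariants\<close>

text \<open>A collection is a function on lists; only its values on nonempty lists over \<open>SS\<close> matter.\<close>

definition act ::
  "(rat \<Rightarrow> 'a :: ring_1 \<Rightarrow> 'a) \<Rightarrow> ((int ^ 'r) list \<Rightarrow> rat) \<Rightarrow> (int ^ 'r \<Rightarrow> 'a) \<Rightarrow> int ^ 'r \<Rightarrow> 'a" where
  "act smul F H \<gamma> = (\<Sum>\<alpha>\<in>decomps \<gamma>. smul (F \<alpha>) (prod_list (map H \<alpha>)))"

text \<open>The invariants \<open>A\<^sub>Z\<close>: the recursion is solved for the summand of the one-element sequence;
  its original form is \<open>stable_inv_recursion\<close> below.\<close>

function stable_inv :: "(int ^ 'r \<Rightarrow> 'a :: ring_1) \<Rightarrow> (int ^ 'r \<Rightarrow> complex) \<Rightarrow> int ^ 'r \<Rightarrow> 'a" where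
  "stable_inv A Z \<gamma> = A \<gamma> -
     (\<Sum>\<alpha> | \<alpha> \<in> decomps \<gamma> \<and> 2 \<le> length \<alpha> \<and> sorted_wrt (\<lambda>a b. slope Z a > slope Z b) \<alpha>.
        prod_list (map (stable_inv A Z) \<alpha>))"
  by auto
termination
proof (relation "measure (\<lambda>(A, Z, \<gamma>). total \<gamma>)", goal_cases)
  case (2 A Z \<gamma> \<alpha> a)
  then show ?case
    using total_decomps_less[of \<alpha> \<gamma> a] by simp
qed simp

declare stable_inv.simps [simp del]

lemma stable_inv_recursion:
  assumes "\<gamma> \<in> SS"
  shows "A \<gamma> = (\<Sum>\<alpha> | \<alpha> \<in> decomps \<gamma> \<and> sorted_wrt (\<lambda>a b. slope Z a > slope Z b) \<alpha>.
                  prod_list (map (stable_inv A Z) \<alpha>))"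
proof -
  let ?D = "{\<alpha> \<in> decomps \<gamma>. 2 \<le> length \<alpha> \<and> sorted_wrt (\<lambda>a b. slope Z a > slope Z b) \<alpha>}"
  have len1: "\<alpha> = [\<gamma>]" if "\<alpha> \<in> decomps \<gamma>" "\<not> 2 \<le> length \<alpha>" for \<alpha>
  proof -
    have "\<alpha> \<noteq> []" "sum_list \<alpha> = \<gamma>"
      using that(1) by (auto simp: decomps_def)
    moreover from this that(2) have "length \<alpha> = 1"
      by (metis One_nat_def length_0_conv less_2_cases not_le)
    ultimately show ?thesis
      by (auto simp: length_Suc_conv)
  qed
  have "{\<alpha> \<in> decomps \<gamma>. sorted_wrt (\<lambda>a b. slope Z a > slope Z b) \<alpha>} = insert [\<gamma>] ?D"
    using assms len1 by (auto simp: decomps_def)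
  moreover have "finite ?D"
    by (rule finite_subset[OF _ finite_decomps[of \<gamma>]]) blast
  moreover have "[\<gamma>] \<notin> ?D"
    by simp
  ultimately show ?thesis
    by (simp add: stable_inv.simps[of A Z \<gamma>])
qed

definition log_coll :: "(int ^ 'r \<Rightarrow> complex) \<Rightarrow> (int ^ 'r) list \<Rightarrow> rat" where
  "log_coll Z \<alpha> = (if \<forall>a\<in>set \<alpha>. \<forall>b\<in>set \<alpha>. slope Z a = slope Z b
                     then (- 1) ^ (length \<alpha> - 1) / of_nat (length \<alpha>) else 0)"

definition bar_inv ::
  "(rat \<Rightarrow> 'a :: ring_1 \<Rightarrow> 'a) \<Rightarrow> (int ^ 'r \<Rightarrow> 'a) \<Rightarrow> (int ^ 'r \<Rightarrow> complex) \<Rightarrow> int ^ 'r \<Rightarrow> 'a" where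
  "bar_inv smul A Z = act smul (log_coll Z) (stable_inv A Z)"

text \<open>The stability parameter \<open>\<langle>-,\<gamma>\<rangle>\<close>, in coordinates.\<close>

definition attractor_stability :: "(int ^ 'r \<Rightarrow> int ^ 'r \<Rightarrow> int) \<Rightarrow> int ^ 'r \<Rightarrow> real ^ 'r" where
  "attractor_stability B \<gamma> = (\<chi> i. real_of_int (B (axis i 1) \<gamma>))"

text \<open>The common value of \<open>bar_inv\<close> at all generic stability parameters close to \<open>\<langle>-,\<gamma>\<rangle>\<close>.\<close>

definition attractor_inv ::
  "(rat \<Rightarrow> 'a :: ring_1 \<Rightarrow> 'a) \<Rightarrow> (int ^ 'r \<Rightarrow> int ^ 'r \<Rightarrow> int) \<Rightarrow> (int ^ 'r \<Rightarrow> 'a) \<Rightarrow> int ^ 'r \<Rightarrow> 'a" where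
  "attractor_inv smul B A \<gamma> =
     (THE x. \<exists>\<epsilon>>0. \<forall>\<theta>'. dist \<theta>' (attractor_stability B \<gamma>) < \<epsilon> \<longrightarrow> generic (charge_of \<theta>') \<longrightarrow>
        bar_inv smul A (charge_of \<theta>') \<gamma> = x)"


section \<open>The collections \<open>g\<^sub>Z\<^sub>,\<^sub>t\<close> and \<open>g\<^sub>*\<^sub>,\<^sub>t\<close>\<close>

definition count_cuts :: "(int ^ 'r \<Rightarrow> int ^ 'r \<Rightarrow> bool) \<Rightarrow> (int ^ 'r) list \<Rightarrow> nat" where
  "count_cuts P \<alpha> = card {k. 1 \<le> k \<and> k < length \<alpha> \<and> P (sum_list (take k \<alpha>)) (sum_list (drop k \<alpha>))}"

definition g_value :: "rat \<Rightarrow> nat \<Rightarrow> nat \<Rightarrow> nat \<Rightarrow> rat" where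
  "g_value t nplus nminus nzero =
     t ^ nminus * (t - 1) ^ nplus * ((t ^ (nzero + 1) - (t - 1) ^ (nzero + 1)) / of_nat (nzero + 1))"

definition g_charge :: "(int ^ 'r \<Rightarrow> complex) \<Rightarrow> rat \<Rightarrow> (int ^ 'r) list \<Rightarrow> rat" where
  "g_charge Z t \<alpha> = g_value t
     (count_cuts (\<lambda>a b. slope Z a > slope Z b) \<alpha>)
     (count_cuts (\<lambda>a b. slope Z a < slope Z b) \<alpha>)
     (count_cuts (\<lambda>a b. slope Z a = slope Z b) \<alpha>)"

definition g_attr :: "(int ^ 'r \<Rightarrow> int ^ 'r \<Rightarrow> int) \<Rightarrow> rat \<Rightarrow> (int ^ 'r) list \<Rightarrow> rat" where
  "g_attr B t \<alpha> = g_value t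
     (count_cuts (\<lambda>a b. B a b > 0) \<alpha>)
     (count_cuts (\<lambda>a b. B a b < 0) \<alpha>)
     (count_cuts (\<lambda>a b. B a b = 0) \<alpha>)"


section \<open>Plane rooted trees\<close>

text \<open>Leaves carry their position, counted from \<open>0\<close>. A vertex is represented by the subtree below it.\<close>

datatype ptree = Leaf nat | Node "ptree list"

fun children :: "ptree \<Rightarrow> ptree list" where
  "children (Leaf i) = []"
| "children (Node ts) = ts"

fun leaves :: "ptree \<Rightarrow> nat list" where
  "leaves (Leaf i) = [i]"
| "leaves (Node ts) = concat (map leaves ts)"

text \<open>All internal vertices, in preorder, so that the root comes first.\<close>

fun internal :: "ptree \<Rightarrow> ptree list" where
  "internal (Leaf i) = []"
| "internal (Node ts) = Node ts # concat (map internal ts)"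

definition trees :: "nat \<Rightarrow> ptree set" where
  "trees n = {T. leaves T = [0..<n] \<and> (\<forall>v\<in>set (internal T). 2 \<le> length (children v))}"

definition vertex_sum :: "(int ^ 'r) list \<Rightarrow> ptree \<Rightarrow> int ^ 'r" where
  "vertex_sum \<alpha> u = (\<Sum>i\<leftarrow>leaves u. \<alpha> ! i)"

definition child_seq :: "(int ^ 'r) list \<Rightarrow> ptree \<Rightarrow> (int ^ 'r) list" where
  "child_seq \<alpha> v = map (vertex_sum \<alpha>) (children v)"

lemma finite_trees: "finite (trees n)"
proof -
  let ?ok = "\<lambda>T. \<forall>v\<in>set (internal T). 2 \<le> length (children v)"
  have nonempty: "?ok T \<Longrightarrow> leaves T \<noteq> []" for T
  proof (induction T)
    case (Node ts)
    then obtain u us where "ts = u # us" by (cases ts) auto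
    with Node show ?case by auto
  qed simp
  have "finite {T. leaves T = xs \<and> ?ok T}" for xs
  proof (induction xs rule: length_induct)
    case (1 xs)
    let ?U = "\<Union>ys\<in>{ys. set ys \<subseteq> set xs \<and> length ys < length xs}. {T. leaves T = ys \<and> ?ok T}"
    have "finite {ys. set ys \<subseteq> set xs \<and> length ys < length xs}"
      by (rule finite_subset[OF _ finite_lists_length_le[of "set xs" "length xs"]]) auto
    then have fin: "finite ?U"
      using 1 by (intro finite_UN_I) auto
    have "{T. leaves T = xs \<and> ?ok T} \<subseteq>
      Leaf ` set xs \<union> Node ` {ts. set ts \<subseteq> ?U \<and> length ts \<le> length xs}"
    proof
      fix T assume T: "T \<in> {T. leaves T = xs \<and> ?ok T}"
      show "T \<in> Leaf ` set xs \<union> Node ` {ts. set ts \<subseteq> ?U \<and> length ts \<le> length xs}"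
      proof (cases T)
        case (Leaf i)
        with T show ?thesis by auto
      next
        case (Node ts)
        have ok: "?ok u" if "u \<in> set ts" for u
          using T Node that by auto
        have xs: "concat (map leaves ts) = xs" and two: "2 \<le> length ts"
          using T Node by auto
        have ne: "leaves u \<noteq> []" if "u \<in> set ts" for u
          using nonempty ok that by blast
        have len: "length us \<le> length (concat (map leaves us))" if "set us \<subseteq> set ts" for us
          using that
        proof (induction us)
          case (Cons u us)
          then show ?case using ne[of u] by (cases "leaves u") auto
        qed simp
        have "u \<in> ?U" if u: "u \<in> set ts" for u
        proof -
          obtain us vs where ts: "ts = us @ u # vs"
            using u by (meson split_list)
          have "set (us @ vs) \<subseteq> set ts"
            unfolding ts by auto
          then have "length (us @ vs) \<le> length (concat (map leaves (us @ vs)))"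
            by (rule len)
          moreover have "length xs = length (leaves u) + length (concat (map leaves (us @ vs)))"
            unfolding xs[symmetric] ts by simp
          moreover have "1 \<le> length (us @ vs)"
            using two ts by simp
          ultimately have "length (leaves u) < length xs"
            by linarith
          moreover have "set (leaves u) \<subseteq> set xs"
            using xs u by auto
          ultimately show ?thesis using ok[OF u] by blast
        qed
        moreover have "length ts \<le> length xs"
          using len[of ts] xs by simp
        ultimately show ?thesis using Node by blast
      qed
    qed
    moreover have "finite (Leaf ` set xs \<union> Node ` {ts. set ts \<subseteq> ?U \<and> length ts \<le> length xs})"
      by (intro finite_UnI finite_imageI finite_set finite_lists_length_le[OF fin])
    ultimately show ?case
      using finite_subset by blast
  qed
  then show ?thesis
    by (simp add: trees_def)
qed

definition F_coll ::
  "(int ^ 'r \<Rightarrow> int ^ 'r \<Rightarrow> int) \<Rightarrow> (int ^ 'r \<Rightarrow> complex) \<Rightarrow> rat \<Rightarrow> (int ^ 'r) list \<Rightarrow> rat" where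
  "F_coll B Z t \<alpha> = (if length \<alpha> = 1 then 1 else
     (\<Sum>T\<in>trees (length \<alpha>).
        (- 1) ^ (length (internal T) - 1)
        * (g_charge Z t (child_seq \<alpha> T) - g_attr B t (child_seq \<alpha> T))
        * (\<Prod>v\<leftarrow>tl (internal T). g_attr B t (child_seq \<alpha> v))))"

end

theory Submission
  imports Defs "HOL-Computational_Algebra.Polynomial" "HOL-Analysis.Continuum_Not_Denumerable"
begin

text \<open>
  Collections are composed by \<open>(F \<circ> G)(\<alpha>) = \<Sum> F(block sums) \<cdot> \<Prod> G(blocks)\<close>, the sum running over the
  splittings of \<open>\<alpha>\<close> into consecutive blocks, and then \<open>F * (G * H) = (F \<circ> G) * H\<close> (\<open>act_comp\<close>). The idea is to
  express the invariants for \<open>Z\<close> and the attractor invariants by one and the same map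
  \<open>C(\<gamma>) = \<Sum> (- t)\<^bsup>n-1\<^esup> A(\<alpha>\<^sub>1)\<dots>A(\<alpha>\<^sub>n)\<close>, in which no stability occurs, and to eliminate \<open>C\<close>.

  The first formula is \<open>g\<^sub>Z * C\<close> for the invariants of \<open>Z\<close> (\<open>bar_inv_eq_act_g_charge\<close>). Slope comparisons at
  the positions of a sequence \<open>\<alpha>\<close> with sum \<open>\<gamma>\<close> are the signs of an additive height along the partial sums
  (\<open>cut_slope_wedge\<close>), and the collections involved are built from products of factors at the positions. Such products
  are composed position by position (\<open>sum_split_weight\<close>). In this way one gets Reineke's inversion of the
  Harder-Narasimhan recursion (\<open>reineke_inversion\<close>), its deformation with parameter \<open>t\<close>
  (\<open>comp_reineke_power\<close>), and the logarithm (\<open>comp_log_stable\<close>); the coefficients of the latter are written as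
  integrals over \<open>[0,1]\<close>, in order that they become products as well.

  The second formula is \<open>g\<^sub>* * C\<close> for the attractor invariants (\<open>attractor_inv_eq_act_g_attr\<close>). Apply the first
  formula to a stability parameter near \<open>\<langle>-,\<gamma>\<rangle>\<close>. It perturbs the heights \<open>\<langle>\<alpha>\<^sub>\<le>\<^sub>k, \<gamma>\<rangle> = \<langle>\<alpha>\<^sub>\<le>\<^sub>k, \<alpha>\<^sub>>\<^sub>k\<rangle>\<close> and
  changes signs only at positions of height \<open>0\<close>. At such a position the two halves of \<open>C(\<alpha>\<^sub>1)\<dots>C(\<alpha>\<^sub>n)\<close> commute, hence
  the product is unchanged if \<open>\<alpha>\<close> is rotated there; and the average of \<open>g\<^sub>Z\<close> over these rotations is \<open>g\<^sub>*(\<alpha>)\<close>,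
  because the contributions of the perturbed heights telescope (\<open>sum_rank_weight\<close>,
  \<open>average_g_charge_rotations\<close>).

  Finally, \<open>g\<^sub>*\<close> is \<open>1\<close> on sequences of length one, so it has a compositional inverse, and unfolding the recursion
  for the inverse gives a signed sum over plane trees (\<open>comp_tree_inverse\<close>). Therefore the invariants of \<open>Z\<close>
  are obtained from the attractor invariants by \<open>g\<^sub>Z \<circ> g\<^sub>*\<^sup>-\<^sup>1\<close>, and separating the root of the trees shows
  that this is the collection of the theorem (\<open>comp_g_charge_tree_inverse\<close>).
\<close>


section \<open>Splittings of a list into consecutive blocks\<close>

definition splits :: "'a list \<Rightarrow> 'a list list set" where
  "splits xs = {xss. concat xss = xs \<and> [] \<notin> set xss}"

lemma splits_single: "splits [x] = {[[x]]}"
proof -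
  have "xss = [[x]]" if "concat xss = [x]" "[] \<notin> set xss" for xss
  proof (cases xss)
    case (Cons ys yss)
    with that obtain zs where "ys = x # zs" "zs @ concat yss = []"
      by (cases ys) auto
    with that Cons show ?thesis by (cases yss) auto
  qed (use that in simp)
  then show ?thesis by (auto simp: splits_def)
qed

lemma splits_Cons:
  assumes "xs \<noteq> []"
  shows "splits (x # xs) =
    (\<lambda>xss. [x] # xss) ` splits xs \<union> (\<lambda>xss. (x # hd xss) # tl xss) ` splits xs"
    (is "_ = ?L \<union> ?R")
proof
  show "splits (x # xs) \<subseteq> ?L \<union> ?R"
  proof
    fix xss assume "xss \<in> splits (x # xs)"
    then obtain zs yss where xss: "xss = (x # zs) # yss" "zs @ concat yss = xs" "[] \<notin> set yss"
      by (cases xss; cases "hd xss") (auto simp: splits_def)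
    show "xss \<in> ?L \<union> ?R"
    proof (cases "zs = []")
      case True
      then show ?thesis using xss by (auto simp: splits_def)
    next
      case False
      then have "zs # yss \<in> splits xs" using xss by (auto simp: splits_def)
      then have "xss \<in> ?R" using xss by (intro image_eqI[of _ _ "zs # yss"]) auto
      then show ?thesis by simp
    qed
  qed
  show "?L \<union> ?R \<subseteq> splits (x # xs)"
  proof -
    have "(x # hd xss) # tl xss \<in> splits (x # xs)" if "xss \<in> splits xs" for xss
      using that assms by (cases xss) (auto simp: splits_def)
    then show ?thesis by (auto simp: splits_def)
  qed
qed

lemma finite_splits: "xs \<noteq> [] \<Longrightarrow> finite (splits xs)"
  by (induction xs rule: list_nonempty_induct) (auto simp: splits_single splits_Cons)

lemma splits_nonempty: "xs \<noteq> [] \<Longrightarrow> xss \<in> splits xs \<Longrightarrow> xss \<noteq> []"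
  by (auto simp: splits_def)

text \<open>The first entry either forms a block of its own or is prepended to the first block of a splitting of
  the rest.\<close>

lemma sum_splits_Cons:
  assumes "xs \<noteq> []"
  shows "(\<Sum>xss\<in>splits (x # xs). f xss) =
    (\<Sum>xss\<in>splits xs. f ([x] # xss) + f ((x # hd xss) # tl xss))"
proof -
  have disj: "(\<lambda>xss. [x] # xss) ` splits xs \<inter> (\<lambda>xss. (x # hd xss) # tl xss) ` splits xs = {}"
  proof -
    have "hd xss \<noteq> []" if "xss \<in> splits xs" for xss
      using that assms by (cases xss) (auto simp: splits_def)
    then show ?thesis by fastforce
  qed
  have inj: "inj_on (\<lambda>xss. (x # hd xss) # tl xss) (splits xs)"
    using splits_nonempty[OF assms] by (auto intro!: inj_onI intro: list.expand)
  show ?thesis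
    unfolding splits_Cons[OF assms]
    using disj inj finite_splits[OF assms]
    by (simp add: sum.union_disjoint sum.reindex inj_on_def sum.distrib)
qed

lemma splits_length_1: "xs \<noteq> [] \<Longrightarrow> {xss \<in> splits xs. \<not> 2 \<le> length xss} = {[xs]}"
proof -
  assume xs: "xs \<noteq> []"
  have "xss = [xs]" if "xss \<in> splits xs" "\<not> 2 \<le> length xss" for xss
    using that splits_nonempty[OF xs that(1)]
    by (cases xss; cases "tl xss") (auto simp: splits_def)
  then show ?thesis using xs by (auto simp: splits_def)
qed

lemma sum_splits_map:
  "xs \<noteq> [] \<Longrightarrow> (\<Sum>yss\<in>splits (map f xs). \<phi> yss) = (\<Sum>xss\<in>splits xs. \<phi> (map (map f) xss))"
proof (induction xs arbitrary: \<phi> rule: list_nonempty_induct)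
  case (single x)
  then show ?case by (simp add: splits_single)
next
  case (cons x xs)
  have "(\<Sum>yss\<in>splits (map f (x # xs)). \<phi> yss) =
      (\<Sum>xss\<in>splits xs. \<phi> ([f x] # map (map f) xss)
        + \<phi> ((f x # hd (map (map f) xss)) # tl (map (map f) xss)))"
    using cons by (simp add: sum_splits_Cons)
  also have "\<dots> = (\<Sum>xss\<in>splits xs. \<phi> (map (map f) ([x] # xss))
        + \<phi> (map (map f) ((x # hd xss) # tl xss)))"
    using splits_nonempty[OF cons(1)] by (intro sum.cong) (auto simp: hd_map map_tl)
  finally show ?case using cons by (simp add: sum_splits_Cons)
qed

text \<open>The weight of a splitting when a position of the list contributes \<open>u\<close> if it separates two blocks and
  \<open>v\<close> if it lies inside a block. Both factors see the whole prefix and the whole suffix of the list at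
  that position, so that conditions on partial sums and on neighbouring entries are both covered.\<close>

fun split_weight :: "('a list \<Rightarrow> 'a list \<Rightarrow> 'b) \<Rightarrow> ('a list \<Rightarrow> 'a list \<Rightarrow> 'b) \<Rightarrow>
    'a list list \<Rightarrow> 'b :: comm_semiring_1" where
  "split_weight u v [] = 1"
| "split_weight u v (b # bs) =
     (\<Prod>k = 1..<length b. v (take k b) (drop k b @ concat bs)) *
     (if bs = [] then 1
      else u b (concat bs) * split_weight (\<lambda>xs. u (b @ xs)) (\<lambda>xs. v (b @ xs)) bs)"

lemma prod_from_1_Suc:
  "(\<Prod>k = Suc 0..<Suc n. f k) =
    (if n = 0 then 1 else f (Suc 0) * (\<Prod>k = Suc 0..<n. f (Suc k)))"
  for f :: "nat \<Rightarrow> 'b :: comm_monoid_mult"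
proof (cases n)
  case (Suc m)
  have "(\<Prod>k = Suc 0..<Suc n. f k) = f (Suc 0) * (\<Prod>k = Suc (Suc 0)..<Suc n. f k)"
    using Suc by (intro prod.atLeast_Suc_lessThan) auto
  then show ?thesis using Suc by (simp only: prod.shift_bounds_Suc_ivl) simp
qed simp

text \<open>Splittings of a list of length \<open>n\<close> correspond to subsets of its \<open>n - 1\<close> positions, so a sum of
  products of independent local weights is a product of the sums \<open>u + v\<close>. The compositions with
  Reineke's collection, with powers of \<open>t\<close> and with the logarithm are instances for suitable \<open>u\<close> and \<open>v\<close>.\<close>

lemma sum_split_weight:
  "xs \<noteq> [] \<Longrightarrow> (\<Sum>bs\<in>splits xs. split_weight u v bs) =
     (\<Prod>k = 1..<length xs. u (take k xs) (drop k xs) + v (take k xs) (drop k xs))"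
proof (induction xs arbitrary: u v rule: list_nonempty_induct)
  case (single x)
  then show ?case by (simp add: splits_single)
next
  case (cons x xs)
  let ?u = "\<lambda>ys. u (x # ys)" and ?v = "\<lambda>ys. v (x # ys)"
  have "split_weight u v ([x] # bs) + split_weight u v ((x # hd bs) # tl bs) =
      (u [x] xs + v [x] xs) * split_weight ?u ?v bs" if bs: "bs \<in> splits xs" for bs
  proof -
    obtain b bs' where bs': "bs = b # bs'" "b \<noteq> []" "b @ concat bs' = xs"
      using bs splits_nonempty[OF cons(1) bs] by (cases bs) (auto simp: splits_def)
    have "split_weight u v ([x] # bs) = u [x] xs * split_weight ?u ?v bs"
      using bs' by simp
    moreover have "split_weight u v ((x # hd bs) # tl bs) = v [x] xs * split_weight ?u ?v bs"
      using bs'(2) bs'(3)[symmetric] unfolding bs'(1)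
      by (simp del: prod.op_ivl_Suc add: prod_from_1_Suc mult.assoc)
    ultimately show ?thesis by (simp add: algebra_simps)
  qed
  then have "(\<Sum>bs\<in>splits (x # xs). split_weight u v bs) =
      (\<Sum>bs\<in>splits xs. (u [x] xs + v [x] xs) * split_weight ?u ?v bs)"
    using cons by (simp add: sum_splits_Cons)
  also have "\<dots> = (u [x] xs + v [x] xs) * (\<Sum>bs\<in>splits xs. split_weight ?u ?v bs)"
    by (simp add: sum_distrib_left)
  also have "\<dots> = (\<Prod>k = 1..<length (x # xs). u (take k (x # xs)) (drop k (x # xs))
      + v (take k (x # xs)) (drop k (x # xs)))"
    using cons unfolding cons.IH
    by (simp del: prod.op_ivl_Suc add: prod_from_1_Suc)
  finally show ?case .
qed

text \<open>Separates the contribution of the sequence of blocks from that of the single blocks, which is the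
  shape of a summand in a composition of collections.\<close>

lemma split_weight_eq_prod:
  "split_weight u v bs =
     (\<Prod>j = 1..<length bs. u (concat (take j bs)) (concat (drop j bs))) *
     (\<Prod>j<length bs. \<Prod>k = 1..<length (bs ! j).
        v (concat (take j bs) @ take k (bs ! j)) (drop k (bs ! j) @ concat (drop (Suc j) bs)))"
proof (induction bs arbitrary: u v)
  case (Cons b bs)
  then show ?case
    by (simp del: prod.op_ivl_Suc prod.lessThan_Suc
        add: prod_from_1_Suc prod.lessThan_Suc_shift ac_simps)
qed simp

lemma prod_list_conv_prod: "prod_list (map f xs) = (\<Prod>j<length xs. f (xs ! j))"
  for f :: "'a \<Rightarrow> 'b :: comm_monoid_mult"
  by (induction xs) (auto simp: prod.lessThan_Suc_shift simp del: prod.lessThan_Suc)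


section \<open>Composition of collections\<close>

text \<open>The operation that makes the action on maps a monoid action, see \<open>act_comp\<close>.\<close>

definition comp_coll :: "('v :: monoid_add list \<Rightarrow> rat) \<Rightarrow> ('v list \<Rightarrow> rat) \<Rightarrow> 'v list \<Rightarrow> rat" where
  "comp_coll F G \<alpha> = (\<Sum>bs\<in>splits \<alpha>. F (map sum_list bs) * prod_list (map G bs))"

definition unit_coll :: "'v list \<Rightarrow> rat" where
  "unit_coll \<alpha> = (if length \<alpha> = 1 then 1 else 0)"

text \<open>Reineke's collection and the powers of \<open>t\<close> have this form. A factor depends on the two sums which its
  position separates, so on block sums it is also a factor of the concatenated list.\<close>

definition cut_prod :: "('v \<Rightarrow> 'v \<Rightarrow> rat) \<Rightarrow> 'v :: monoid_add list \<Rightarrow> rat" where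
  "cut_prod c \<alpha> = (\<Prod>k = 1..<length \<alpha>. c (sum_list (take k \<alpha>)) (sum_list (drop k \<alpha>)))"

lemma sum_list_concat: "sum_list (concat bs) = sum_list (map sum_list bs)"
  by (induction bs) (auto simp: add.assoc)

text \<open>The hypothesis \<open>local\<close> says that \<open>v\<close> only looks at the immediate neighbourhood of a position; then
  a factor inside a block is the same, whether computed in the block or in the whole list.\<close>

lemma comp_cut_prod:
  assumes G: "\<And>b. G b = (\<Prod>k = 1..<length b. v (take k b) (drop k b))"
    and local: "\<And>ps xs ys qs. xs \<noteq> [] \<Longrightarrow> ys \<noteq> [] \<Longrightarrow> v (ps @ xs) (ys @ qs) = v xs ys"
    and "\<alpha> \<noteq> []"
  shows "comp_coll (cut_prod c) G \<alpha> = (\<Prod>k = 1..<length \<alpha>.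
    c (sum_list (take k \<alpha>)) (sum_list (drop k \<alpha>)) + v (take k \<alpha>) (drop k \<alpha>))"
proof -
  have "cut_prod c (map sum_list bs) * prod_list (map G bs) =
      split_weight (\<lambda>xs ys. c (sum_list xs) (sum_list ys)) v bs" for bs
  proof -
    have "G (bs ! j) = (\<Prod>k = 1..<length (bs ! j).
        v (concat (take j bs) @ take k (bs ! j)) (drop k (bs ! j) @ concat (drop (Suc j) bs)))"
      for j
      unfolding G by (intro prod.cong refl local[symmetric]) auto
    then show ?thesis
      by (simp add: split_weight_eq_prod cut_prod_def prod_list_conv_prod sum_list_concat
          take_map drop_map)
  qed
  then show ?thesis
    using sum_split_weight[OF assms(3), of "\<lambda>xs ys. c (sum_list xs) (sum_list ys)" v]
    by (simp add: comp_coll_def)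
qed

lemma decomps_subset: "\<alpha> \<in> decomps \<gamma> \<Longrightarrow> set \<alpha> \<subseteq> SS"
  by (simp add: decomps_def)

lemma SS_add: "a \<in> SS \<Longrightarrow> b \<in> SS \<Longrightarrow> a + b \<in> SS"
proof -
  assume ab: "a \<in> SS" "b \<in> SS"
  then have "total (a + b) \<noteq> total 0"
    using total_pos[of a] by (simp add: total_add SS_def) (simp add: total_def)
  then show ?thesis using ab NN_add by (auto simp: SS_def)
qed

lemma sum_list_in_SS: "\<alpha> \<noteq> [] \<Longrightarrow> set \<alpha> \<subseteq> SS \<Longrightarrow> sum_list \<alpha> \<in> SS"
  by (induction \<alpha> rule: list_nonempty_induct) (auto intro: SS_add)

lemma prod_list_sum:
  fixes f :: "'x \<Rightarrow> 'b :: semiring_1"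
  assumes "\<And>X. X \<in> set Xs \<Longrightarrow> finite X"
  shows "prod_list (map (\<lambda>X. \<Sum>x\<in>X. f x) Xs) = (\<Sum>xs\<in>listset Xs. prod_list (map f xs))"
  using assms
proof (induction Xs)
  case (Cons X Xs)
  have "set_Cons X (listset Xs) = (\<lambda>(x, xs). x # xs) ` (X \<times> listset Xs)"
    by (auto simp: set_Cons_def)
  moreover have "inj_on (\<lambda>(x, xs). x # xs) (X \<times> listset Xs)"
    by (auto intro: inj_onI)
  ultimately have "(\<Sum>xs\<in>listset (X # Xs). prod_list (map f xs)) =
      (\<Sum>(x, xs)\<in>X \<times> listset Xs. f x * prod_list (map f xs))"
    by (simp add: sum.reindex case_prod_unfold)
  also have "\<dots> = (\<Sum>x\<in>X. f x) * (\<Sum>xs\<in>listset Xs. prod_list (map f xs))"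
    by (simp add: sum_product sum.cartesian_product)
  finally show ?case using Cons by simp
qed simp

lemma listset_iff: "xs \<in> listset Xs \<longleftrightarrow> list_all2 (\<in>) xs Xs"
  by (induction Xs arbitrary: xs) (auto simp: set_Cons_def list_all2_Cons2)

lemma finite_listset: "(\<And>X. X \<in> set Xs \<Longrightarrow> finite X) \<Longrightarrow> finite (listset Xs)"
proof (induction Xs)
  case (Cons X Xs)
  have "set_Cons X (listset Xs) = (\<lambda>(x, xs). x # xs) ` (X \<times> listset Xs)"
    by (auto simp: set_Cons_def)
  then show ?case using Cons by simp
qed simp

lemma listset_decomps:
  assumes "\<alpha> \<in> decomps \<gamma>"
  shows "listset (map decomps \<alpha>) =
    {bs. map sum_list bs = \<alpha> \<and> [] \<notin> set bs \<and> set (concat bs) \<subseteq> SS}"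
proof -
  have "bs \<in> listset (map decomps as) \<longleftrightarrow>
      map sum_list bs = as \<and> [] \<notin> set bs \<and> set (concat bs) \<subseteq> SS" for bs as
    unfolding listset_iff
    by (induction as arbitrary: bs) (auto simp: decomps_def list_all2_Cons2 Cons_eq_map_conv, blast+)
  then show ?thesis by blast
qed

lemma act_cong:
  assumes "\<And>\<alpha>. \<alpha> \<in> decomps \<gamma> \<Longrightarrow> F \<alpha> = F' \<alpha>" and "\<And>\<delta>. \<delta> \<in> SS \<Longrightarrow> H \<delta> = H' \<delta>"
  shows "act smul F H \<gamma> = act smul F' H' \<gamma>"
  unfolding act_def using assms decomps_subset
  by (intro sum.cong refl arg_cong2[of _ _ _ _ smul] arg_cong[of _ _ prod_list]) fastforce+

lemma decomps_length_1: 
  assumes "\<gamma> \<in> SS"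
  shows "{\<alpha> \<in> decomps \<gamma>. length \<alpha> = 1} = {[\<gamma>]}"
  using assms by (auto simp: decomps_def length_Suc_conv)

context graded_rat_algebra
begin

text \<open>Expanding each factor \<open>(G * H)(\<alpha>\<^sub>i)\<close> turns the left-hand side into a sum over lists of nonempty blocks;
  grouping these by the list of block sums gives the left-hand side, and grouping them by their
  concatenation gives the right-hand side.\<close>

lemma act_comp: "act smul F (act smul G H) \<gamma> = act smul (comp_coll F G) H \<gamma>"
proof -
  let ?BB = "{bs. concat bs \<in> decomps \<gamma> \<and> [] \<notin> set bs}"
  let ?t = "\<lambda>bs. smul (F (map sum_list bs) * prod_list (map G bs)) (prod_list (map H (concat bs)))"
  have smul_prod: "prod_list (map (\<lambda>b. smul (G b) (P b)) bs) =
      smul (prod_list (map G bs)) (prod_list (map P bs))" for bs P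
    by (induction bs) (auto simp: smul_mult_left smul_mult_right)
  have prod_concat: "prod_list (map (\<lambda>b. prod_list (map H b)) bs) = prod_list (map H (concat bs))"
    for bs by (induction bs) auto
  have fib1: "{bs \<in> ?BB. map sum_list bs = \<alpha>} = listset (map decomps \<alpha>)"
    if \<alpha>: "\<alpha> \<in> decomps \<gamma>" for \<alpha>
    using \<alpha> unfolding listset_decomps[OF \<alpha>]
    by (auto simp: decomps_def sum_list_concat) (metis list.set_sel(1))
  have "?BB = (\<Union>\<alpha>\<in>decomps \<gamma>. splits \<alpha>)"
    by (auto simp: splits_def)
  then have fin: "finite ?BB"
    using finite_splits finite_decomps[of \<gamma>] by (auto simp: decomps_def)
  have into: "map sum_list ` ?BB \<subseteq> decomps \<gamma>"
    by (fastforce simp: decomps_def sum_list_concat intro!: sum_list_in_SS)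
  have expand: "prod_list (map (act smul G H) \<alpha>) = (\<Sum>bs\<in>listset (map decomps \<alpha>).
      prod_list (map (\<lambda>b. smul (G b) (prod_list (map H b))) bs))" for \<alpha>
    by (subst prod_list_sum[symmetric]) (auto simp: act_def[abs_def] o_def finite_decomps)
  have "act smul F (act smul G H) \<gamma> =
      (\<Sum>\<alpha>\<in>decomps \<gamma>. smul (F \<alpha>) (\<Sum>bs\<in>listset (map decomps \<alpha>).
         prod_list (map (\<lambda>b. smul (G b) (prod_list (map H b))) bs)))"
    unfolding expand[symmetric] by (simp add: act_def[of smul F])
  also have "\<dots> = (\<Sum>\<alpha>\<in>decomps \<gamma>. \<Sum>bs\<in>listset (map decomps \<alpha>). ?t bs)"
    unfolding smul_prod prod_concat scale_sum_right
    by (intro sum.cong refl) (auto simp: listset_decomps)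
  also have "\<dots> = (\<Sum>\<alpha>\<in>decomps \<gamma>. \<Sum>bs\<in>{bs \<in> ?BB. map sum_list bs = \<alpha>}. ?t bs)"
    by (intro sum.cong refl fib1[symmetric])
  also have "\<dots> = (\<Sum>bs\<in>?BB. ?t bs)"
    by (rule sum.group[OF fin finite_decomps into])
  also have "\<dots> = (\<Sum>\<alpha>\<in>decomps \<gamma>. \<Sum>bs\<in>{bs \<in> ?BB. concat bs = \<alpha>}. ?t bs)"
    by (rule sum.group[OF fin finite_decomps, symmetric]) auto
  also have "\<dots> = act smul (comp_coll F G) H \<gamma>"
    unfolding act_def comp_coll_def scale_sum_left
    by (intro sum.cong) (auto simp: splits_def)
  finally show ?thesis .
qed

lemma act_unit_coll: "\<gamma> \<in> SS \<Longrightarrow> act smul unit_coll H \<gamma> = H \<gamma>"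
proof -
  assume \<gamma>: "\<gamma> \<in> SS"
  have "act smul unit_coll H \<gamma> = (\<Sum>\<alpha>\<in>{\<alpha> \<in> decomps \<gamma>. length \<alpha> = 1}. prod_list (map H \<alpha>))"
    unfolding act_def unit_coll_def
    by (intro sum.mono_neutral_cong_right finite_decomps) auto
  then show ?thesis by (simp only: decomps_length_1[OF \<gamma>]) simp
qed

text \<open>In \<open>(F * X)(\<gamma>)\<close> the term of the one-entry list is \<open>X(\<gamma>)\<close>, and all others involve \<open>X\<close> at smaller
  dimension vectors only.\<close>

lemma act_unitriangular_inj:
  assumes F: "\<And>\<gamma>. \<gamma> \<in> SS \<Longrightarrow> F [\<gamma>] = 1"
    and eq: "\<And>\<gamma>. \<gamma> \<in> SS \<Longrightarrow> act smul F X \<gamma> = act smul F Y \<gamma>"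
    and "\<gamma> \<in> SS"
  shows "X \<gamma> = Y \<gamma>"
  using \<open>\<gamma> \<in> SS\<close>
proof (induction "total \<gamma>" arbitrary: \<gamma> rule: less_induct)
  case less
  let ?D = "{\<alpha> \<in> decomps \<gamma>. length \<alpha> \<noteq> 1}"
  have split: "act smul F H \<gamma> = H \<gamma> + (\<Sum>\<alpha>\<in>?D. smul (F \<alpha>) (prod_list (map H \<alpha>)))" for H
  proof -
    have "decomps \<gamma> = {\<alpha> \<in> decomps \<gamma>. length \<alpha> = 1} \<union> ?D" by blast
    then have D: "decomps \<gamma> = insert [\<gamma>] ?D" unfolding decomps_length_1[OF less(2)] by simp
    have "act smul F H \<gamma> = (\<Sum>\<alpha>\<in>insert [\<gamma>] ?D. smul (F \<alpha>) (prod_list (map H \<alpha>)))"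
      unfolding act_def by (rule sum.cong[OF D refl])
    also have "\<dots> = H \<gamma> + (\<Sum>\<alpha>\<in>?D. smul (F \<alpha>) (prod_list (map H \<alpha>)))"
      using finite_decomps[of \<gamma>] F[OF less(2)] by (subst sum.insert) auto
    finally show ?thesis .
  qed
  have "X a = Y a" if "\<alpha> \<in> ?D" "a \<in> set \<alpha>" for \<alpha> a
  proof -
    have "2 \<le> length \<alpha>" using that by (cases \<alpha>; cases "tl \<alpha>") auto
    then show ?thesis
      using that less(1)[of a] total_decomps_less[of \<alpha> \<gamma> a] decomps_subset[of \<alpha> \<gamma>] by blast
  qed
  then have "(\<Sum>\<alpha>\<in>?D. smul (F \<alpha>) (prod_list (map X \<alpha>))) =
      (\<Sum>\<alpha>\<in>?D. smul (F \<alpha>) (prod_list (map Y \<alpha>)))"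
    by (intro sum.cong refl arg_cong2[of _ _ _ _ smul] arg_cong[of _ _ prod_list]) auto
  then show ?case using eq[OF less(2)] unfolding split by simp
qed

lemma prod_list_component:
  assumes "set \<alpha> \<subseteq> SS" "\<And>a. a \<in> SS \<Longrightarrow> H a \<in> R a"
  shows "prod_list (map H \<alpha>) \<in> R (sum_list \<alpha>)"
  using assms(1)
proof (induction \<alpha>)
  case Nil
  then show ?case using one_component by simp
next
  case (Cons a \<alpha>)
  then show ?case
    using total_sum_list[of \<alpha>] assms(2)[of a] by (auto intro!: mult_component simp: SS_def)
qed

lemma act_component:
  assumes "\<gamma> \<in> SS" "\<And>a. a \<in> SS \<Longrightarrow> H a \<in> R a"
  shows "act smul F H \<gamma> \<in> R \<gamma>"
proof -
  have "subspace (R \<gamma>)" using assms(1) subspace_component by (auto simp: SS_def)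
  then show ?thesis
    unfolding act_def
    using prod_list_component[OF decomps_subset assms(2)]
    by (intro subspace_sum subspace_scale) (auto simp: decomps_def)
qed

end


section \<open>Inverting a collection by a sum over trees\<close>

text \<open>Subtrees in general carry leaf labels that do not start at \<open>0\<close>, so a recursion over trees needs
  arbitrary label lists.\<close>

definition trees_on :: "nat list \<Rightarrow> ptree set" where
  "trees_on xs = {T. leaves T = xs \<and> (\<forall>v\<in>set (internal T). 2 \<le> length (children v))}"

definition tree_inverse_on ::
  "((int ^ 'r) list \<Rightarrow> rat) \<Rightarrow> (int ^ 'r) list \<Rightarrow> nat list \<Rightarrow> rat" where
  "tree_inverse_on g \<alpha> xs = (\<Sum>T\<in>trees_on xs.
     (- 1) ^ length (internal T) * (\<Prod>v\<leftarrow>internal T. g (child_seq \<alpha> v)))"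

text \<open>The inverse of \<open>g\<close> for composition, see \<open>comp_tree_inverse\<close>.\<close>

definition tree_inverse :: "((int ^ 'r) list \<Rightarrow> rat) \<Rightarrow> (int ^ 'r) list \<Rightarrow> rat" where
  "tree_inverse g \<alpha> = tree_inverse_on g \<alpha> [0..<length \<alpha>]"

lemma block_shorter:
  assumes "xss \<in> splits xs" "2 \<le> length xss" "ys \<in> set xss"
  shows "length ys < length xs"
proof -
  obtain us vs where xss: "xss = us @ ys # vs" using assms(3) by (meson split_list)
  then have "us @ vs \<noteq> []" "[] \<notin> set (us @ vs)"
    using assms by (auto simp: splits_def)
  then have "concat (us @ vs) \<noteq> []" by (metis concat_eq_Nil_conv list.set_sel(1))
  moreover have "length xs = length ys + length (concat (us @ vs))"
    using assms(1) xss by (auto simp: splits_def)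
  ultimately show ?thesis by (simp only: length_greater_0_conv[symmetric])
qed

lemma leaves_nonempty:
  "\<forall>v\<in>set (internal T). 2 \<le> length (children v) \<Longrightarrow> leaves T \<noteq> []"
proof (induction T)
  case (Node ts)
  then obtain u us where "ts = u # us" by (cases ts) auto
  with Node show ?case by auto
qed simp

lemma trees_on_listset:
  "ts \<in> listset (map trees_on xss) \<longleftrightarrow>
   map leaves ts = xss \<and> (\<forall>t\<in>set ts. \<forall>v\<in>set (internal t). 2 \<le> length (children v))"
  unfolding listset_iff
  by (induction xss arbitrary: ts) (auto simp: trees_on_def list_all2_Cons2)

text \<open>Removing the root of a tree leaves a splitting of its leaf labels into at least two blocks, together
  with a tree on each block.\<close>

lemma trees_on_eq:
  assumes "2 \<le> length xs"
  shows "trees_on xs =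
    Node ` (\<Union>xss\<in>{xss \<in> splits xs. 2 \<le> length xss}. listset (map trees_on xss))"
    (is "_ = Node ` ?U")
proof (intro equalityI subsetI)
  fix T assume T: "T \<in> trees_on xs"
  then obtain ts where ts: "T = Node ts"
    using assms by (cases T) (auto simp: trees_on_def)
  let ?xss = "map leaves ts"
  have ok: "\<forall>t\<in>set ts. \<forall>v\<in>set (internal t). 2 \<le> length (children v)"
    using T ts by (auto simp: trees_on_def)
  then have "[] \<notin> set ?xss" using leaves_nonempty by fastforce
  then have "?xss \<in> {xss \<in> splits xs. 2 \<le> length xss}"
    using T ts by (auto simp: trees_on_def splits_def)
  moreover have "ts \<in> listset (map trees_on ?xss)"
    using ok by (subst trees_on_listset) simp
  ultimately show "T \<in> Node ` ?U" using ts by blast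
next
  fix T assume "T \<in> Node ` ?U"
  then show "T \<in> trees_on xs"
    by (auto simp: trees_on_listset trees_on_def splits_def)
qed

lemma trees_on_single: "trees_on [x] = {Leaf x}"
proof -
  have False if T: "T \<in> trees_on [x]" "T = Node ts" for T ts
  proof -
    have ok: "\<forall>t\<in>set ts. leaves t \<noteq> []"
      using T leaves_nonempty by (fastforce simp: trees_on_def)
    obtain u v us where "ts = u # v # us"
      using T by (cases ts; cases "tl ts") (auto simp: trees_on_def)
    then show False using T ok by (auto simp: trees_on_def append_eq_Cons_conv)
  qed
  then have "T = Leaf x" if "T \<in> trees_on [x]" for T
    using that by (cases T) (auto simp: trees_on_def)
  then show ?thesis by (auto simp: trees_on_def)
qed

lemma finite_trees_on: "xs \<noteq> [] \<Longrightarrow> finite (trees_on xs)"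
proof (induction xs rule: length_induct)
  case (1 xs)
  show ?case
  proof (cases "2 \<le> length xs")
    case False
    with 1(2) obtain x where "xs = [x]" by (cases xs; cases "tl xs") auto
    then show ?thesis by (simp add: trees_on_single)
  next
    case True
    have "finite (trees_on ys)" if "xss \<in> splits xs" "2 \<le> length xss" "ys \<in> set xss" for xss ys
    proof -
      have "ys \<noteq> []" using that by (auto simp: splits_def)
      moreover have "length ys < length xs"
        using that block_shorter by blast
      ultimately show ?thesis using 1(1) by blast
    qed
    then show ?thesis
      unfolding trees_on_eq[OF True]
      using finite_splits[OF 1(2)] by (intro finite_imageI finite_UN_I finite_listset) auto
  qed
qed

lemma sum_trees_on:
  assumes "2 \<le> length xs"
  shows "(\<Sum>T\<in>trees_on xs. \<phi> T) = (\<Sum>xss | xss \<in> splits xs \<and> 2 \<le> length xss.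
    \<Sum>ts\<in>listset (map trees_on xss). \<phi> (Node ts))"
proof -
  have "xs \<noteq> []" using assms by auto
  then have fin: "finite {xss \<in> splits xs. 2 \<le> length xss}"
    by (simp add: finite_splits)
  have fin2: "finite (listset (map trees_on xss))" if "xss \<in> splits xs" for xss
    using that by (intro finite_listset) (auto simp: splits_def intro!: finite_trees_on)
  have "(\<Sum>T\<in>trees_on xs. \<phi> T) =
      (\<Sum>ts\<in>(\<Union>xss\<in>{xss \<in> splits xs. 2 \<le> length xss}. listset (map trees_on xss)). \<phi> (Node ts))"
    unfolding trees_on_eq[OF assms] by (subst sum.reindex) (auto simp: inj_on_def)
  also have "\<dots> = (\<Sum>xss | xss \<in> splits xs \<and> 2 \<le> length xss.
      \<Sum>ts\<in>listset (map trees_on xss). \<phi> (Node ts))"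
    using fin fin2 by (intro sum.UNION_disjoint) (auto simp: trees_on_listset)
  finally show ?thesis .
qed

text \<open>The sum over all trees whose root is weighted by \<open>f\<close> and whose other vertices are weighted by \<open>-g\<close>:
  for a fixed splitting at the root, the subtrees vary independently. With \<open>f = g\<close> this is, up to sign, the
  recursion of the tree inverse, and with \<open>f = g\<^sub>Z - g\<^sub>*\<close> it is the collection of the theorem.\<close>

lemma sum_trees_on_signed:
  assumes "2 \<le> length xs"
  shows "(\<Sum>T\<in>trees_on xs. (- 1) ^ (length (internal T) - 1) * f (child_seq \<alpha> T) *
      (\<Prod>v\<leftarrow>tl (internal T). g (child_seq \<alpha> v))) =
    (\<Sum>bs | bs \<in> splits xs \<and> 2 \<le> length bs.
      f (map (\<lambda>ys. sum_list (map ((!) \<alpha>) ys)) bs) * (\<Prod>ys\<leftarrow>bs. tree_inverse_on g \<alpha> ys))"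
  unfolding sum_trees_on[OF assms]
proof (intro sum.cong refl)
  fix bs assume bs: "bs \<in> {bs \<in> splits xs. 2 \<le> length bs}"
  let ?w = "\<lambda>T. (- 1) ^ length (internal T) * (\<Prod>v\<leftarrow>internal T. g (child_seq \<alpha> v)) :: rat"
  have prod: "(- 1) ^ length (concat (map internal ts)) *
      (\<Prod>v\<leftarrow>concat (map internal ts). g (child_seq \<alpha> v)) = prod_list (map ?w ts)" for ts
    by (induction ts) (auto simp: power_add)
  have "(\<Sum>ts\<in>listset (map trees_on bs). (- 1) ^ (length (internal (Node ts)) - 1) *
        f (child_seq \<alpha> (Node ts)) * (\<Prod>v\<leftarrow>tl (internal (Node ts)). g (child_seq \<alpha> v))) =
      (\<Sum>ts\<in>listset (map trees_on bs).
        f (map (\<lambda>ys. sum_list (map ((!) \<alpha>) ys)) bs) * prod_list (map ?w ts))"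
  proof (intro sum.cong refl)
    fix ts assume "ts \<in> listset (map trees_on bs)"
    then have "child_seq \<alpha> (Node ts) = map (\<lambda>ys. sum_list (map ((!) \<alpha>) ys)) bs"
      by (auto simp: trees_on_listset child_seq_def vertex_sum_def)
    then show "(- 1) ^ (length (internal (Node ts)) - 1) * f (child_seq \<alpha> (Node ts)) *
        (\<Prod>v\<leftarrow>tl (internal (Node ts)). g (child_seq \<alpha> v)) =
      f (map (\<lambda>ys. sum_list (map ((!) \<alpha>) ys)) bs) * prod_list (map ?w ts)"
      unfolding prod[symmetric] by (simp only: internal.simps list.sel list.size) simp
  qed
  also have "\<dots> = f (map (\<lambda>ys. sum_list (map ((!) \<alpha>) ys)) bs) *
      (\<Sum>ts\<in>listset (map trees_on bs). prod_list (map ?w ts))"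
    by (simp add: sum_distrib_left)
  also have "(\<Sum>ts\<in>listset (map trees_on bs). prod_list (map ?w ts)) =
      (\<Prod>ys\<leftarrow>bs. tree_inverse_on g \<alpha> ys)"
    unfolding tree_inverse_on_def
    using bs
    by (subst prod_list_sum[symmetric]) (auto simp: splits_def o_def intro!: finite_trees_on)
  finally show "(\<Sum>ts\<in>listset (map trees_on bs). (- 1) ^ (length (internal (Node ts)) - 1) *
        f (child_seq \<alpha> (Node ts)) * (\<Prod>v\<leftarrow>tl (internal (Node ts)). g (child_seq \<alpha> v))) =
      f (map (\<lambda>ys. sum_list (map ((!) \<alpha>) ys)) bs) * (\<Prod>ys\<leftarrow>bs. tree_inverse_on g \<alpha> ys)" .
qed

lemma tree_inverse_on_rec:
  assumes "2 \<le> length xs"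
  shows "tree_inverse_on g \<alpha> xs = - (\<Sum>bs | bs \<in> splits xs \<and> 2 \<le> length bs.
    g (map (\<lambda>ys. sum_list (map ((!) \<alpha>) ys)) bs) * (\<Prod>ys\<leftarrow>bs. tree_inverse_on g \<alpha> ys))"
proof -
  have "(- 1) ^ length (internal T) * (\<Prod>v\<leftarrow>internal T. g (child_seq \<alpha> v)) =
      - ((- 1) ^ (length (internal T) - 1) * g (child_seq \<alpha> T) *
        (\<Prod>v\<leftarrow>tl (internal T). g (child_seq \<alpha> v)))" if "T \<in> trees_on xs" for T
    using that assms by (cases T) (auto simp: trees_on_def)
  then show ?thesis
    unfolding sum_trees_on_signed[OF assms, symmetric]
    by (simp add: tree_inverse_on_def sum_negf)
qed

text \<open>Only the entries at the leaf labels matter, so the sums over subtrees in the recursion are again tree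
  inverses, now of blocks of \<open>\<alpha>\<close>.\<close>

lemma tree_inverse_on_eq:
  "xs \<noteq> [] \<Longrightarrow> tree_inverse_on g \<alpha> xs = tree_inverse g (map ((!) \<alpha>) xs)"
proof (induction xs arbitrary: \<alpha> rule: length_induct)
  case (1 xs)
  let ?s = "\<lambda>\<alpha> ys. sum_list (map ((!) \<alpha>) ys)"
  show ?case
  proof (cases "2 \<le> length xs")
    case False
    with 1(2) obtain x where "xs = [x]" by (cases xs; cases "tl xs") auto
    then show ?thesis by (simp add: tree_inverse_def tree_inverse_on_def trees_on_single)
  next
    case True
    have rec: "tree_inverse_on g \<beta> zs = - (\<Sum>cs\<in>splits (map ((!) \<beta>) zs). if 2 \<le> length cs
        then g (map sum_list cs) * (\<Prod>c\<leftarrow>cs. tree_inverse g c) else 0)"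
      if zs: "length zs = length xs" for \<beta> zs
    proof -
      have ne: "zs \<noteq> []" using zs True by auto
      have "tree_inverse_on g \<beta> zs = - (\<Sum>bs\<in>splits zs. if 2 \<le> length bs
          then g (map (?s \<beta>) bs) * (\<Prod>ys\<leftarrow>bs. tree_inverse_on g \<beta> ys) else 0)"
        using tree_inverse_on_rec[of zs] zs True
        by (simp add: sum.inter_filter finite_splits[OF ne])
      also have "\<dots> = - (\<Sum>bs\<in>splits zs. if 2 \<le> length (map (map ((!) \<beta>)) bs)
          then g (map sum_list (map (map ((!) \<beta>)) bs)) *
            (\<Prod>c\<leftarrow>map (map ((!) \<beta>)) bs. tree_inverse g c) else 0)"
      proof -
        have "tree_inverse_on g \<beta> ys = tree_inverse g (map ((!) \<beta>) ys)"
          if "bs \<in> splits zs" "2 \<le> length bs" "ys \<in> set bs" for bs ys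
          using 1(1) block_shorter[OF that] that zs by (auto simp: splits_def)
        then have "(\<Prod>ys\<leftarrow>bs. tree_inverse_on g \<beta> ys) =
            (\<Prod>ys\<leftarrow>bs. tree_inverse g (map ((!) \<beta>) ys))"
          if "bs \<in> splits zs" "2 \<le> length bs" for bs
          using that by (intro arg_cong[of _ _ prod_list] map_cong) auto
        then show ?thesis
          by (intro arg_cong[of _ _ uminus] sum.cong) (auto simp: o_def)
      qed
      also have "\<dots> = - (\<Sum>cs\<in>splits (map ((!) \<beta>) zs). if 2 \<le> length cs
          then g (map sum_list cs) * (\<Prod>c\<leftarrow>cs. tree_inverse g c) else 0)"
        by (simp only: sum_splits_map[OF ne])
      finally show ?thesis .
    qed
    have "map ((!) (map ((!) \<alpha>) xs)) [0..<length xs] = map ((!) \<alpha>) xs"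
      using map_nth[of "map ((!) \<alpha>) xs"] by simp
    then show ?thesis
      using rec[of xs \<alpha>] rec[of "[0..<length xs]" "map ((!) \<alpha>) xs"]
      by (simp add: tree_inverse_def)
  qed
qed

lemma tree_inverse_single: "tree_inverse g [a] = 1"
  by (simp add: tree_inverse_def tree_inverse_on_def trees_on_single)

lemma sum_splits_upt:
  assumes "\<alpha> \<noteq> []"
  shows "(\<Sum>bs | bs \<in> splits [0..<length \<alpha>] \<and> 2 \<le> length bs.
      f (map (\<lambda>ys. sum_list (map ((!) \<alpha>) ys)) bs) * (\<Prod>ys\<leftarrow>bs. tree_inverse_on g \<alpha> ys)) =
    (\<Sum>bs | bs \<in> splits \<alpha> \<and> 2 \<le> length bs.
      f (map sum_list bs) * (\<Prod>b\<leftarrow>bs. tree_inverse g b))"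
    (is "?l = ?r")
proof -
  have upt: "[0..<length \<alpha>] \<noteq> []" using assms by simp
  have blocks: "(\<Prod>ys\<leftarrow>bs. tree_inverse_on g \<alpha> ys) =
      (\<Prod>ys\<leftarrow>bs. tree_inverse g (map ((!) \<alpha>) ys))" if "bs \<in> splits [0..<length \<alpha>]" for bs
    using that by (intro arg_cong[of _ _ prod_list] map_cong refl tree_inverse_on_eq)
      (auto simp: splits_def)
  have "?l = (\<Sum>bs\<in>splits [0..<length \<alpha>]. if 2 \<le> length bs
      then f (map (\<lambda>ys. sum_list (map ((!) \<alpha>) ys)) bs) *
        (\<Prod>ys\<leftarrow>bs. tree_inverse_on g \<alpha> ys) else 0)"
    by (simp add: sum.inter_filter finite_splits[OF upt])
  also have "\<dots> = (\<Sum>bs\<in>splits [0..<length \<alpha>]. if 2 \<le> length (map (map ((!) \<alpha>)) bs)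
      then f (map sum_list (map (map ((!) \<alpha>)) bs)) *
        (\<Prod>c\<leftarrow>map (map ((!) \<alpha>)) bs. tree_inverse g c) else 0)"
    by (intro sum.cong refl) (simp add: blocks o_def)
  also have "\<dots> = (\<Sum>bs\<in>splits (map ((!) \<alpha>) [0..<length \<alpha>]). if 2 \<le> length bs
      then f (map sum_list bs) * (\<Prod>c\<leftarrow>bs. tree_inverse g c) else 0)"
    by (simp only: sum_splits_map[OF upt])
  also have "\<dots> = ?r"
    using assms by (simp add: sum.inter_filter finite_splits map_nth)
  finally show ?thesis .
qed

lemma comp_split_first:
  assumes "\<alpha> \<noteq> []"
  shows "comp_coll f g \<alpha> = f [sum_list \<alpha>] * g \<alpha> +
    (\<Sum>bs | bs \<in> splits \<alpha> \<and> 2 \<le> length bs. f (map sum_list bs) * prod_list (map g bs))"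
proof -
  have "splits \<alpha> = {bs \<in> splits \<alpha>. \<not> 2 \<le> length bs} \<union> {bs \<in> splits \<alpha>. 2 \<le> length bs}"
    by blast
  then have *: "splits \<alpha> = insert [\<alpha>] {bs \<in> splits \<alpha>. 2 \<le> length bs}"
    unfolding splits_length_1[OF assms] by simp
  have "comp_coll f g \<alpha> = (\<Sum>bs\<in>insert [\<alpha>] {bs \<in> splits \<alpha>. 2 \<le> length bs}.
      f (map sum_list bs) * prod_list (map g bs))"
    unfolding comp_coll_def by (rule sum.cong[OF * refl])
  also have "\<dots> = f [sum_list \<alpha>] * g \<alpha> +
    (\<Sum>bs | bs \<in> splits \<alpha> \<and> 2 \<le> length bs. f (map sum_list bs) * prod_list (map g bs))"
    using finite_splits[OF assms] by (subst sum.insert) auto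
  finally show ?thesis .
qed

lemma tree_inverse_rec:
  assumes "2 \<le> length \<alpha>"
  shows "tree_inverse g \<alpha> = - (\<Sum>bs | bs \<in> splits \<alpha> \<and> 2 \<le> length bs.
    g (map sum_list bs) * (\<Prod>b\<leftarrow>bs. tree_inverse g b))"
proof -
  have "\<alpha> \<noteq> []" using assms by auto
  from sum_splits_upt[OF this, of g g] show ?thesis
    using tree_inverse_on_rec[of "[0..<length \<alpha>]" g \<alpha>] assms by (simp add: tree_inverse_def)
qed

text \<open>In the composition, the trivial splitting contributes the tree inverse of the whole list, and by
  \<open>tree_inverse_rec\<close> the other splittings contribute its negative.\<close>

lemma comp_tree_inverse:
  assumes "\<And>a. g [a] = 1" "\<alpha> \<noteq> []"
  shows "comp_coll g (tree_inverse g) \<alpha> = unit_coll \<alpha>"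
proof (cases "2 \<le> length \<alpha>")
  case True
  then show ?thesis
    unfolding comp_split_first[OF assms(2)] using tree_inverse_rec[OF True, of g] assms(1)
    by (simp add: unit_coll_def)
next
  case False
  with assms(2) obtain a where "\<alpha> = [a]" by (cases \<alpha>; cases "tl \<alpha>") auto
  then show ?thesis
    using assms(1) by (simp add: comp_coll_def splits_single unit_coll_def tree_inverse_single)
qed

lemma count_cuts_single: "count_cuts P [a] = 0"
  unfolding count_cuts_def by (subst card_eq_0_iff) auto

lemma g_attr_single: "g_attr B t [a] = 1"
  by (simp add: g_attr_def g_value_def count_cuts_single)

lemma g_charge_single: "g_charge Z t [a] = 1"
  by (simp add: g_charge_def g_value_def count_cuts_single)

text \<open>The trivial splitting contributes the tree inverse of \<open>\<alpha>\<close>, which is minus the sum of \<open>g\<^sub>*\<close> over the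
  proper splittings. This is where the difference \<open>g\<^sub>Z - g\<^sub>*\<close> at the root comes from.\<close>

lemma comp_g_charge_tree_inverse:
  assumes "\<alpha> \<noteq> []"
  shows "comp_coll (g_charge Z t) (tree_inverse (g_attr B t)) \<alpha> = F_coll B Z t \<alpha>"
proof (cases "2 \<le> length \<alpha>")
  case True
  have "comp_coll (g_charge Z t) (tree_inverse (g_attr B t)) \<alpha> =
    (\<Sum>bs | bs \<in> splits \<alpha> \<and> 2 \<le> length bs. (g_charge Z t (map sum_list bs) -
       g_attr B t (map sum_list bs)) * (\<Prod>b\<leftarrow>bs. tree_inverse (g_attr B t) b))"
    unfolding comp_split_first[OF assms] tree_inverse_rec[OF True]
    by (simp add: g_charge_single left_diff_distrib sum_subtractf)
  also have "\<dots> = F_coll B Z t \<alpha>"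
    using True sum_splits_upt[OF assms, of "\<lambda>bs. g_charge Z t bs - g_attr B t bs", symmetric]
      sum_trees_on_signed[of "[0..<length \<alpha>]" "\<lambda>bs. g_charge Z t bs - g_attr B t bs"]
    by (simp add: F_coll_def trees_def trees_on_def)
  finally show ?thesis .
next
  case False
  with assms obtain a where "\<alpha> = [a]" by (cases \<alpha>; cases "tl \<alpha>") auto
  then show ?thesis
    by (simp add: comp_coll_def splits_single F_coll_def tree_inverse_single g_charge_single)
qed


section \<open>Slopes of partial sums\<close>

lemma additive_axis_expansion:
  fixes f :: "int ^ 'r \<Rightarrow> 'b :: ring_1"
  assumes "additive f"
  shows "f x = (\<Sum>i\<in>UNIV. of_int (x $ i) * f (axis i 1))"
proof -
  interpret additive f by fact
  have axis: "f (axis i n) = of_int n * f (axis i 1)" for i and n :: int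
  proof -
    have plus: "axis i (a + b) = axis i a + (axis i b :: int ^ 'r)" for a b
      by (auto simp: axis_def vec_eq_iff)
    have "additive (\<lambda>n :: int. f (axis i n))"
      by unfold_locales (simp add: plus add)
    then interpret ax: additive "\<lambda>n :: int. f (axis i n)" .
    show ?thesis
    proof (induction n rule: int_induct[of _ 0])
      case base
      then show ?case using ax.zero by simp
    next
      case (step1 n)
      then show ?case using ax.add[of n 1] by (simp add: algebra_simps)
    next
      case (step2 n)
      then show ?case using ax.diff[of n 1] by (simp add: algebra_simps)
    qed
  qed
  have "x = (\<Sum>i\<in>UNIV. axis i (x $ i))"
    by (auto simp: vec_eq_iff axis_def)
  then have "f x = f (\<Sum>i\<in>UNIV. axis i (x $ i))" by simp
  also have "\<dots> = (\<Sum>i\<in>UNIV. f (axis i (x $ i)))" by (rule sum)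
  also have "\<dots> = (\<Sum>i\<in>UNIV. of_int (x $ i) * f (axis i 1))" 
    by (intro sum.cong refl axis)
  finally show ?thesis .
qed

lemma central_charge_Im_pos:
  assumes "central_charge Z" "a \<in> SS"
  shows "0 < Im (Z a)"
proof -
  have "Im (Z a) = (\<Sum>i\<in>UNIV. of_int (a $ i) * Im (Z (axis i 1)))"
    using additive_axis_expansion[of Z a] assms(1) by (simp add: central_charge_def)
  moreover obtain i where "a $ i \<noteq> 0" using assms(2) by (auto simp: SS_def vec_eq_iff)
  moreover have "0 \<le> a $ j" "0 < Im (Z (axis j 1))" for j
    using assms by (auto simp: SS_def NN_def central_charge_def)
  ultimately have "0 < a $ i" "Im (Z a) = (\<Sum>i\<in>UNIV. of_int (a $ i) * Im (Z (axis i 1)))"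
    "\<And>j. 0 \<le> a $ j" "\<And>j. 0 < Im (Z (axis j 1))"
    by (auto simp: order_less_le)
  then show ?thesis
    by (simp only:) (rule sum_pos2[of _ i], auto intro!: mult_nonneg_nonneg intro: less_imp_le)
qed

text \<open>Up to positive factors the difference of the slopes. In contrast to the slope it is bilinear and
  skew-symmetric, so it behaves like \<open>\<langle>-,-\<rangle>\<close>, and it is defined at \<open>0\<close>.\<close>

definition wedge :: "(int ^ 'r \<Rightarrow> complex) \<Rightarrow> int ^ 'r \<Rightarrow> int ^ 'r \<Rightarrow> real" where
  "wedge Z x y = Re (Z y) * Im (Z x) - Re (Z x) * Im (Z y)"

lemma wedge_self [simp]: "wedge Z x x = 0"
  by (simp add: wedge_def)

lemma central_charge_add: "central_charge Z \<Longrightarrow> Z (x + y) = Z x + Z y"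
  by (simp add: central_charge_def additive.add[of Z])

lemma central_charge_zero: "central_charge Z \<Longrightarrow> Z 0 = 0"
  by (simp add: central_charge_def additive.zero[of Z])

lemma wedge_add_left:
  "central_charge Z \<Longrightarrow> wedge Z (x + y) z = wedge Z x z + wedge Z y z"
  by (simp add: wedge_def central_charge_add algebra_simps)

lemma wedge_add_right:
  "central_charge Z \<Longrightarrow> wedge Z z (x + y) = wedge Z z x + wedge Z z y"
  by (simp add: wedge_def central_charge_add algebra_simps)

lemma wedge_zero_left: "central_charge Z \<Longrightarrow> wedge Z 0 z = 0"
  by (simp add: wedge_def central_charge_zero)

lemma slope_less_iff:
  assumes "central_charge Z" "x \<in> SS" "y \<in> SS"
  shows "slope Z x < slope Z y \<longleftrightarrow> wedge Z x y < 0"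
  using central_charge_Im_pos[OF assms(1,2)] central_charge_Im_pos[OF assms(1,3)]
  by (simp add: slope_def wedge_def field_simps)

lemma slope_greater_iff:
  assumes "central_charge Z" "x \<in> SS" "y \<in> SS"
  shows "slope Z y < slope Z x \<longleftrightarrow> 0 < wedge Z x y"
  using central_charge_Im_pos[OF assms(1,2)] central_charge_Im_pos[OF assms(1,3)]
  by (simp add: slope_def wedge_def field_simps)

lemma slope_eq_iff:
  assumes "central_charge Z" "x \<in> SS" "y \<in> SS"
  shows "slope Z x = slope Z y \<longleftrightarrow> wedge Z x y = 0"
  using slope_less_iff[OF assms] slope_greater_iff[OF assms] by linarith

text \<open>The slope of a sum lies between the slopes of the summands.\<close>

lemma slope_sum_list:
  assumes "central_charge Z" "\<alpha> \<noteq> []" "set \<alpha> \<subseteq> SS" "\<And>a. a \<in> set \<alpha> \<Longrightarrow> slope Z a = s"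
  shows "slope Z (sum_list \<alpha>) = s"
  using assms(2-)
proof (induction \<alpha> rule: list_nonempty_induct)
  case (cons a \<alpha>)
  then have S: "a \<in> SS" "sum_list \<alpha> \<in> SS" by (auto intro: sum_list_in_SS)
  then have "wedge Z a (sum_list \<alpha>) = 0"
    using cons by (simp flip: slope_eq_iff[OF assms(1)])
  then have "wedge Z a (a + sum_list \<alpha>) = 0" by (simp add: wedge_add_right[OF assms(1)])
  then have "slope Z a = slope Z (a + sum_list \<alpha>)"
    using S by (simp add: slope_eq_iff[OF assms(1)] SS_add)
  then show ?case using cons by simp
qed simp

lemma take_drop_SS:
  assumes "set \<alpha> \<subseteq> SS" "k \<in> {1..<length \<alpha>}"
  shows "sum_list (take k \<alpha>) \<in> SS" "sum_list (drop k \<alpha>) \<in> SS"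
  using assms by (auto intro!: sum_list_in_SS dest: in_set_takeD in_set_dropD)

lemma sum_list_take_drop: "sum_list (take k \<alpha>) + sum_list (drop k \<alpha>) = sum_list \<alpha>"
  by (metis append_take_drop_id sum_list_append)

text \<open>By skew-symmetry, pairing a partial sum with its complement is the same as pairing it with the total
  sum. So a sequence becomes a walk with the additive height \<open>wedge Z _ (sum_list \<alpha>)\<close>, which starts and
  ends at height \<open>0\<close>, and \<open>n\<^sub>+\<close>, \<open>n\<^sub>-\<close>, \<open>n\<^sub>0\<close> count its positive, negative and zero heights.\<close>

lemma cut_slope_wedge:
  assumes "central_charge Z" "set \<alpha> \<subseteq> SS" "k \<in> {1..<length \<alpha>}"
  shows "slope Z (sum_list (take k \<alpha>)) > slope Z (sum_list (drop k \<alpha>)) \<longleftrightarrow>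
      wedge Z (sum_list (take k \<alpha>)) (sum_list \<alpha>) > 0"
    and "slope Z (sum_list (take k \<alpha>)) < slope Z (sum_list (drop k \<alpha>)) \<longleftrightarrow>
      wedge Z (sum_list (take k \<alpha>)) (sum_list \<alpha>) < 0"
    and "slope Z (sum_list (take k \<alpha>)) = slope Z (sum_list (drop k \<alpha>)) \<longleftrightarrow>
      wedge Z (sum_list (take k \<alpha>)) (sum_list \<alpha>) = 0"
  using wedge_add_right[OF assms(1), of "sum_list (take k \<alpha>)" "sum_list (take k \<alpha>)" "sum_list (drop k \<alpha>)"]
    slope_less_iff[OF assms(1) take_drop_SS[OF assms(2,3)]]
    slope_greater_iff[OF assms(1) take_drop_SS[OF assms(2,3)]]
    slope_eq_iff[OF assms(1) take_drop_SS[OF assms(2,3)]]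
  by (simp_all add: sum_list_take_drop)

lemma last_take_hd_drop:
  assumes "k \<in> {1..<length \<alpha>}"
  shows "last (take k \<alpha>) = \<alpha> ! (k - 1)" "hd (drop k \<alpha>) = \<alpha> ! k"
proof -
  obtain j where "k = Suc j" using assms by (cases k) auto
  then show "last (take k \<alpha>) = \<alpha> ! (k - 1)"
    using assms by (simp add: take_Suc_conv_app_nth)
  show "hd (drop k \<alpha>) = \<alpha> ! k" using assms by (simp add: hd_drop_conv_nth)
qed

section \<open>Reineke inversion\<close>

text \<open>The Harder-Narasimhan recursion reads \<open>A = hn_coll Z * A\<^sub>Z\<close>.\<close>

definition hn_coll :: "(int ^ 'r \<Rightarrow> complex) \<Rightarrow> (int ^ 'r) list \<Rightarrow> rat" where
  "hn_coll Z \<alpha> = (if sorted_wrt (\<lambda>a b. slope Z a > slope Z b) \<alpha> then 1 else 0)"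

lemma hn_coll_prod:
  "hn_coll Z b = (\<Prod>k = 1..<length b.
     if slope Z (last (take k b)) > slope Z (hd (drop k b)) then 1 else 0)"
proof -
  have "(\<Prod>k = 1..<length b. if slope Z (last (take k b)) > slope Z (hd (drop k b)) then 1 else 0)
      = (\<Prod>k = 1..<length b. if slope Z (b ! (k - 1)) > slope Z (b ! k) then 1 else 0 :: rat)"
    by (intro prod.cong) (simp_all only: last_take_hd_drop)
  also have "\<dots> = hn_coll Z b"
  proof (cases "sorted_wrt (\<lambda>a b. slope Z a > slope Z b) b")
    case True
    then show ?thesis
      by (auto simp: hn_coll_def sorted_wrt_iff_nth_less intro!: prod.neutral)
  next
    case False
    have tr: "transp (\<lambda>a b. slope Z a > slope Z b)"
      by (auto intro: transpI)
    obtain i where "Suc i < length b" "\<not> slope Z (b ! i) > slope Z (b ! Suc i)"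
      using sorted_wrt_iff_nth_Suc_transp[OF tr, of b] False by auto
    then have "\<exists>k\<in>{1..<length b}. (if slope Z (b ! (k - 1)) > slope Z (b ! k) then 1 else 0 :: rat) = 0"
      by (intro bexI[of _ "Suc i"]) auto
    then show ?thesis using False by (simp add: hn_coll_def)
  qed
  finally show ?thesis by simp
qed

text \<open>Suppose that the two sides differ at every position. If the walk of \<open>cut_slope_wedge\<close> starts with a
  positive step, then it is positive at the first position, hence the slope does not drop there and the
  next step is positive as well; inductively the walk never returns to \<open>0\<close>. If it starts with a step
  \<open>\<le> 0\<close>, then the slope drops at every position, and the walk ends below \<open>0\<close>.\<close>

lemma exists_cancelling_cut:
  assumes Z: "central_charge Z" and S: "set \<alpha> \<subseteq> SS" and n: "2 \<le> length \<alpha>"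
  shows "\<exists>k\<in>{1..<length \<alpha>}. slope Z (sum_list (take k \<alpha>)) > slope Z (sum_list (drop k \<alpha>)) \<longleftrightarrow>
    slope Z (\<alpha> ! (k - 1)) > slope Z (\<alpha> ! k)"
proof (rule ccontr)
  define \<gamma> where "\<gamma> = sum_list \<alpha>"
  define P where "P k = wedge Z (sum_list (take k \<alpha>)) \<gamma>" for k
  define L where "L k = wedge Z (\<alpha> ! k) \<gamma>" for k
  assume "\<not> ?thesis"
  then have step: "P k > 0 \<longleftrightarrow> \<not> slope Z (\<alpha> ! (k - 1)) > slope Z (\<alpha> ! k)"
    if "k \<in> {1..<length \<alpha>}" for k
    using that cut_slope_wedge(1)[OF Z S that] unfolding P_def \<gamma>_def by blast
  have P_Suc: "P (Suc k) = P k + L k" if "k < length \<alpha>" for k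
    using that by (simp add: P_def L_def take_Suc_conv_app_nth wedge_add_left[OF Z])
  have P0: "P 0 = 0" by (simp add: P_def wedge_zero_left[OF Z])
  have Pn: "P (length \<alpha>) = 0" by (simp add: P_def \<gamma>_def)
  have "\<alpha> \<noteq> []" using n by auto
  then have \<gamma>: "\<gamma> \<in> SS" using S by (auto simp: \<gamma>_def intro: sum_list_in_SS)
  have L: "0 < L k \<longleftrightarrow> slope Z (\<alpha> ! k) > slope Z \<gamma>" if "k < length \<alpha>" for k
    unfolding L_def using that S \<gamma> nth_mem[of k \<alpha>] by (intro slope_greater_iff[OF Z, symmetric]) auto
  have L': "L k < 0 \<longleftrightarrow> slope Z (\<alpha> ! k) < slope Z \<gamma>" if "k < length \<alpha>" for k
    unfolding L_def using that S \<gamma> nth_mem[of k \<alpha>] by (intro slope_less_iff[OF Z, symmetric]) auto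
  show False
  proof (cases "0 < L 0")
    case True
    have "k < length \<alpha> \<Longrightarrow> 0 < P (Suc k) \<and> 0 < L k" for k
    proof (induction k)
      case 0
      then show ?case using True P_Suc[of 0] P0 by simp
    next
      case (Suc k)
      then have IH: "k < length \<alpha>" "Suc k \<in> {1..<length \<alpha>}" "0 < P (Suc k)" "0 < L k" by auto
      then have "slope Z \<gamma> < slope Z (\<alpha> ! Suc k)"
        using step[OF IH(2)] L[OF IH(1)] by simp
      then have "0 < L (Suc k)" using L Suc.prems by simp
      then show ?case using IH(3) P_Suc[OF Suc.prems] by simp
    qed
    from this[of "length \<alpha> - 1"] show False using Pn n by (cases "length \<alpha>") auto
  next
    case False
    have "k < length \<alpha> \<Longrightarrow> P (Suc k) \<le> 0 \<and> L k \<le> 0 \<and> (0 < k \<longrightarrow> P (Suc k) < 0)" for k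
    proof (induction k)
      case 0
      then show ?case using False P_Suc[of 0] P0 by simp
    next
      case (Suc k)
      then have IH: "k < length \<alpha>" "Suc k \<in> {1..<length \<alpha>}" "P (Suc k) \<le> 0" "L k \<le> 0" by auto
      then have "slope Z (\<alpha> ! Suc k) < slope Z \<gamma>"
        using step[OF IH(2)] L[OF IH(1)] by simp
      then have "L (Suc k) < 0" using L' Suc.prems by simp
      then show ?case using IH(3) P_Suc[OF Suc.prems] by simp
    qed
    from this[of "length \<alpha> - 1"] show False using Pn n by (cases "length \<alpha>") auto
  qed
qed

text \<open>Reineke's resolution of the Harder-Narasimhan recursion: the sign \<open>(-1)\<^bsup>n-1\<^esup>\<close> if all heights of the walk
  are positive, and \<open>0\<close> otherwise.\<close>

definition reineke_coll :: "(int ^ 'r \<Rightarrow> complex) \<Rightarrow> (int ^ 'r) list \<Rightarrow> rat" where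
  "reineke_coll Z = cut_prod (\<lambda>a b. if slope Z a > slope Z b then - 1 else 0)"

text \<open>Both collections are products of local factors, a block boundary contributing \<open>-1\<close> at a positive height
  and the inside of a block contributing \<open>1\<close> at a drop of slopes. The resulting product contains a
  vanishing factor by \<open>exists_cancelling_cut\<close>.\<close>

lemma reineke_inversion:
  assumes "central_charge Z" "\<alpha> \<noteq> []" "set \<alpha> \<subseteq> SS"
  shows "comp_coll (reineke_coll Z) (hn_coll Z) \<alpha> = unit_coll \<alpha>"
proof -
  have "comp_coll (reineke_coll Z) (hn_coll Z) \<alpha> = (\<Prod>k = 1..<length \<alpha>.
      (if slope Z (sum_list (take k \<alpha>)) > slope Z (sum_list (drop k \<alpha>)) then - 1 else 0) +
      (if slope Z (last (take k \<alpha>)) > slope Z (hd (drop k \<alpha>)) then 1 else 0))" (is "_ = ?P")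
    unfolding reineke_coll_def using assms(2)
    by (intro comp_cut_prod hn_coll_prod) auto
  also have "?P = unit_coll \<alpha>"
  proof (cases "2 \<le> length \<alpha>")
    case True
    obtain k where k: "k \<in> {1..<length \<alpha>}"
      "slope Z (sum_list (take k \<alpha>)) > slope Z (sum_list (drop k \<alpha>)) \<longleftrightarrow>
       slope Z (\<alpha> ! (k - 1)) > slope Z (\<alpha> ! k)"
      using exists_cancelling_cut[OF assms(1,3) True] by blast
    then have "?P = 0" using last_take_hd_drop[OF k(1)]
      by (intro prod_zero bexI[OF _ k(1)]) auto
    then show ?thesis using True by (simp add: unit_coll_def)
  next
    case False
    with assms(2) obtain a where "\<alpha> = [a]" by (cases \<alpha>; cases "tl \<alpha>") auto
    then show ?thesis by (simp add: unit_coll_def)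
  qed
  finally show ?thesis .
qed

text \<open>\<open>t\<^bsup>n-1\<^esup>\<close> on sequences of length \<open>n\<close>, the coefficients of \<open>x/(1 - tx)\<close>. The compositional inverse of
  that series is \<open>x/(1 + tx)\<close>.\<close>

definition power_coll :: "rat \<Rightarrow> 'v :: monoid_add list \<Rightarrow> rat" where
  "power_coll t = cut_prod (\<lambda>_ _. t)"

text \<open>The collection that expresses \<open>A\<^sub>Z\<close> by the map \<open>C\<close> with \<open>A = power_coll t * C\<close>, see
  \<open>comp_reineke_power\<close>.\<close>

definition stable_coll :: "(int ^ 'r \<Rightarrow> complex) \<Rightarrow> rat \<Rightarrow> (int ^ 'r) list \<Rightarrow> rat" where
  "stable_coll Z t = cut_prod (\<lambda>a b. if slope Z a > slope Z b then t - 1 else t)"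

lemma comp_reineke_power:
  assumes "\<alpha> \<noteq> []"
  shows "comp_coll (reineke_coll Z) (power_coll t) \<alpha> = stable_coll Z t \<alpha>"
proof -
  have "comp_coll (reineke_coll Z) (power_coll t) \<alpha> = (\<Prod>k = 1..<length \<alpha>.
      (if slope Z (sum_list (take k \<alpha>)) > slope Z (sum_list (drop k \<alpha>)) then - 1 else 0) + t)"
    unfolding reineke_coll_def using assms
    by (intro comp_cut_prod) (auto simp: power_coll_def cut_prod_def)
  also have "\<dots> = stable_coll Z t \<alpha>"
    unfolding stable_coll_def cut_prod_def by (intro prod.cong) auto
  finally show ?thesis .
qed

lemma comp_power_power_uminus:
  assumes "\<alpha> \<noteq> []"
  shows "comp_coll (power_coll t) (power_coll (- t)) \<alpha> = unit_coll \<alpha>"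
proof -
  have "comp_coll (power_coll t) (power_coll (- t)) \<alpha> = (\<Prod>k = 1..<length \<alpha>. t + - t)"
    unfolding power_coll_def[of t] using assms
    by (intro comp_cut_prod) (auto simp: power_coll_def cut_prod_def)
  also have "\<dots> = unit_coll \<alpha>"
    using assms by (cases \<alpha>) (auto simp: unit_coll_def)
  finally show ?thesis .
qed


section \<open>The collection of the logarithm\<close>

text \<open>For \<open>N\<close> larger than the degree this is the integral over \<open>[0,1]\<close>; the bound \<open>N\<close> makes it additive by
  definition. It produces the coefficients \<open>1/n\<close> of the logarithm.\<close>

definition unit_integral :: "nat \<Rightarrow> rat poly \<Rightarrow> rat" where
  "unit_integral N p = (\<Sum>i<N. coeff p i / of_nat (Suc i))"

lemma unit_integral_sum: "unit_integral N (\<Sum>x\<in>X. f x) = (\<Sum>x\<in>X. unit_integral N (f x))"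
  unfolding unit_integral_def coeff_sum sum_divide_distrib by (rule sum.swap)

lemma unit_integral_smult: "unit_integral N (smult c p) = c * unit_integral N p"
  by (simp add: unit_integral_def sum_distrib_left)

lemma unit_integral_monom: "i < N \<Longrightarrow> unit_integral N (monom c i) = c / of_nat (Suc i)"
proof -
  assume i: "i < N"
  have "unit_integral N (monom c i) = (\<Sum>j<N. if j = i then c / of_nat (Suc i) else 0)"
    unfolding unit_integral_def by (intro sum.cong) (auto simp: coeff_monom)
  then show ?thesis using i by (simp add: sum.delta)
qed

text \<open>The fundamental theorem of calculus for the antiderivative \<open>-(t - x)\<^bsup>n+1\<^esup>/(n + 1)\<close> of \<open>(t - x)\<^bsup>n\<^esup>\<close>.\<close>

lemma unit_integral_power:
  assumes "n < N"
  shows "unit_integral N ([:t, -1:] ^ n) = (t ^ (n + 1) - (t - 1) ^ (n + 1)) / of_nat (n + 1)"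
proof -
  define q :: "rat poly" where "q = [:t, -1:] ^ Suc n"
  have "pderiv q = - smult (of_nat (Suc n)) ([:t, -1:] ^ n)"
    unfolding q_def pderiv_power_Suc by (simp add: pderiv_pCons flip: one_pCons smult_minus_left)
  then have "of_nat (Suc n) * coeff ([:t, -1:] ^ n) i = - (of_nat (Suc i) * coeff q (Suc i))" for i
    by (metis (no_types, lifting) coeff_minus coeff_pderiv coeff_smult minus_minus)
  then have coeff: "coeff ([:t, -1:] ^ n) i / of_nat (Suc i) = - coeff q (Suc i) / of_nat (Suc n)" for i
    by (simp add: field_simps del: of_nat_Suc)
  have "degree q \<le> Suc n"
    unfolding q_def using degree_power_le[of "[:t, -1:]" "Suc n"] by simp
  then have deg: "degree q \<le> N" using assms by simp
  have "poly q 1 = (\<Sum>i\<le>degree q. coeff q i)" by (simp add: poly_altdef)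
  also have "\<dots> = (\<Sum>i\<le>N. coeff q i)"
    using deg by (intro sum.mono_neutral_left) (auto simp: coeff_eq_0)
  also have "\<dots> = coeff q 0 + (\<Sum>i<N. coeff q (Suc i))"
    by (simp add: lessThan_Suc_atMost[symmetric] sum.lessThan_Suc_shift del: sum.lessThan_Suc)
  also have "coeff q 0 = poly q 0" by (simp add: poly_0_coeff_0)
  finally have "(\<Sum>i<N. coeff q (Suc i)) = poly q 1 - poly q 0" by simp
  also have "\<dots> = (t - 1) ^ Suc n - t ^ Suc n" by (simp add: q_def algebra_simps)
  finally have "unit_integral N ([:t, -1:] ^ n) = - ((t - 1) ^ Suc n - t ^ Suc n) / of_nat (Suc n)"
    unfolding unit_integral_def coeff
    by (simp add: sum_negf diff_divide_distrib flip: sum_divide_distrib)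
  then show ?thesis by simp
qed

lemma prod_const_poly: "(\<Prod>x\<in>A. [:f x:]) = [:\<Prod>x\<in>A. f x:]"
  by (induction A rule: infinite_finite_induct) (auto simp: mult.commute)

lemma prod_three_cases:
  fixes a b c :: "'b :: comm_monoid_mult"
  assumes "finite K" "\<And>k. k \<in> K \<Longrightarrow> P k \<or> Q k \<or> R k"
    "\<And>k. \<not> (P k \<and> Q k)" "\<And>k. \<not> (P k \<and> R k)" "\<And>k. \<not> (Q k \<and> R k)"
  shows "(\<Prod>k\<in>K. if P k then a else if Q k then b else c) =
    a ^ card {k \<in> K. P k} * b ^ card {k \<in> K. Q k} * c ^ card {k \<in> K. R k}"
proof -
  have "K \<inter> {k. P k} = {k \<in> K. P k}" "K \<inter> - {k. P k} \<inter> {k. Q k} = {k \<in> K. Q k}"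
    "K \<inter> - {k. P k} \<inter> - {k. Q k} = {k \<in> K. R k}"
    using assms(2-5) by blast+
  then show ?thesis
    using assms(1) by (simp add: prod.If_cases mult.assoc)
qed

lemma count_cuts_eq:
  "count_cuts P \<alpha> = card {k \<in> {1..<length \<alpha>}. P (sum_list (take k \<alpha>)) (sum_list (drop k \<alpha>))}"
  unfolding count_cuts_def by (rule arg_cong[of _ _ card]) auto

text \<open>In a splitting with blocks of equal slope, all block boundaries are at height \<open>0\<close>, and if there are \<open>p\<close>
  of them the logarithm contributes \<open>(-1)\<^bsup>p\<^esup>/(p + 1)\<close>, which is the integral of \<open>(-x)\<^bsup>p\<^esup>\<close> over \<open>[0,1]\<close>. Hence
  the composition is the integral of a product of local factors: \<open>t - 1\<close> at positive heights, \<open>t\<close> at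
  negative heights, and \<open>t - x\<close> at zeros. The factor \<open>(t - x) ^ n\<^sub>0\<close> integrates to the last factor of \<open>g\<^sub>Z\<close>.\<close>

lemma comp_log_stable:
  fixes Z :: "int ^ 'r \<Rightarrow> complex"
  assumes Z: "central_charge Z" and ne: "\<alpha> \<noteq> []" and S: "set \<alpha> \<subseteq> SS"
  shows "comp_coll (log_coll Z) (stable_coll Z t) \<alpha> = g_charge Z t \<alpha>"
proof -
  define \<gamma> where "\<gamma> = sum_list \<alpha>"
  have \<gamma>: "\<gamma> \<in> SS" using ne S by (auto simp: \<gamma>_def intro: sum_list_in_SS)
  define N where "N = length \<alpha>"
  define c :: "int ^ 'r \<Rightarrow> int ^ 'r \<Rightarrow> rat"
    where "c x y = (if slope Z x > slope Z y then t - 1 else t)" for x y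
  define u :: "(int ^ 'r) list \<Rightarrow> (int ^ 'r) list \<Rightarrow> rat poly"
    where "u xs ys = (if slope Z (sum_list xs) = slope Z (sum_list ys) then [:0, -1:] else 0)"
    for xs ys
  define v :: "(int ^ 'r) list \<Rightarrow> (int ^ 'r) list \<Rightarrow> rat poly"
    where "v xs ys = [:c (sum_list xs) (sum_list ys):]" for xs ys
  have summand: "log_coll Z (map sum_list bs) * prod_list (map (stable_coll Z t) bs) =
      unit_integral N (split_weight u v bs)" if bs: "bs \<in> splits \<alpha>" for bs
  proof -
    define m where "m = length bs"
    define pre where "pre j = sum_list (concat (take j bs))" for j
    define post where "post j = sum_list (concat (drop j bs))" for j
    have cat: "concat bs = \<alpha>" and nonempty: "[] \<notin> set bs" using bs by (auto simp: splits_def)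
    have bne: "bs \<noteq> []" using bs splits_nonempty[OF ne] by blast
    have m: "0 < m" using bne by (simp add: m_def)
    have mN: "m - 1 < N"
    proof -
      have "length bs \<le> length (concat bs)"
        using nonempty
      proof (induction bs)
        case (Cons b bs)
        then show ?case by (cases b) auto
      qed simp
      then show ?thesis using m unfolding m_def N_def cat by linarith
    qed
    have bS: "set b \<subseteq> SS" "b \<noteq> []" if "b \<in> set bs" for b
    proof -
      have "set b \<subseteq> set \<alpha>" using that cat by auto
      then show "set b \<subseteq> SS" using S by blast
      show "b \<noteq> []" using that nonempty by blast
    qed
    have sS: "set (map sum_list bs) \<subseteq> SS"
      using bS by (auto intro!: sum_list_in_SS)
    have len: "length (map sum_list bs) = m" by (simp add: m_def)
    have sum_s: "sum_list (map sum_list bs) = \<gamma>"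
      unfolding \<gamma>_def cat[symmetric] by (simp add: sum_list_concat)
    have pre_eq: "pre j = sum_list (take j (map sum_list bs))"
      and post_eq: "post j = sum_list (drop j (map sum_list bs))" for j
      by (simp_all add: pre_def post_def sum_list_concat take_map drop_map)
    have first: "(\<Prod>j = 1..<m. u (concat (take j bs)) (concat (drop j bs))) =
        (if \<forall>j\<in>{1..<m}. wedge Z (pre j) \<gamma> = 0 then monom ((- 1) ^ (m - 1)) (m - 1) else 0)"
    proof -
      have u_eq: "u (concat (take j bs)) (concat (drop j bs)) =
          (if wedge Z (pre j) \<gamma> = 0 then [:0, -1:] else 0)" if "j \<in> {1..<m}" for j
        using cut_slope_wedge(3)[OF Z sS, of j] that
        by (simp add: u_def sum_s m_def pre_eq sum_list_concat take_map drop_map)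
      have "[:0, -1:] = monom (- 1 :: rat) 1" by (simp add: monom_altdef)
      then have pow: "[:0, -1:] ^ (m - 1) = monom ((- 1 :: rat) ^ (m - 1)) (m - 1)"
        by (simp add: monom_power)
      show ?thesis
      proof (cases "\<forall>j\<in>{1..<m}. wedge Z (pre j) \<gamma> = 0")
        case True
        then have "(\<Prod>j = 1..<m. u (concat (take j bs)) (concat (drop j bs))) = [:0, -1:] ^ (m - 1)"
          using u_eq by simp
        then show ?thesis using True pow by simp
      next
        case False
        then obtain j where j: "j \<in> {1..<m}" "wedge Z (pre j) \<gamma> \<noteq> 0" by blast
        then have "(\<Prod>j = 1..<m. u (concat (take j bs)) (concat (drop j bs))) = 0"
          using u_eq by (intro prod_zero bexI[of _ j]) auto
        then show ?thesis unfolding if_not_P[OF False] .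
      qed
    qed
    show ?thesis
    proof (cases "\<forall>j\<in>{1..<m}. wedge Z (pre j) \<gamma> = 0")
      case False
      have "log_coll Z (map sum_list bs) = 0"
      proof (rule ccontr)
        assume "log_coll Z (map sum_list bs) \<noteq> 0"
        then have all: "\<forall>a\<in>set (map sum_list bs). \<forall>b\<in>set (map sum_list bs). slope Z a = slope Z b"
          unfolding log_coll_def by (metis (lifting) if_not_P)
        have "sum_list (hd bs) \<in> set (map sum_list bs)" using bne by simp
        then have eq: "slope Z a = slope Z (sum_list (hd bs))" if "a \<in> set (map sum_list bs)" for a
          using all that by blast
        have "wedge Z (pre j) \<gamma> = 0" if j: "j \<in> {1..<m}" for j
        proof -
          have j': "j \<in> {1..<length (map sum_list bs)}" using j len by simp
          have "slope Z (pre j) = slope Z (sum_list (hd bs))"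
            unfolding pre_eq
          proof (rule slope_sum_list[OF Z])
            show "take j (map sum_list bs) \<noteq> []" using j' by auto
            show "set (take j (map sum_list bs)) \<subseteq> SS" using sS set_take_subset by fast
            show "slope Z a = slope Z (sum_list (hd bs))" if "a \<in> set (take j (map sum_list bs))" for a
              by (rule eq[OF in_set_takeD[OF that]])
          qed
          moreover have "slope Z (post j) = slope Z (sum_list (hd bs))"
            unfolding post_eq
          proof (rule slope_sum_list[OF Z])
            show "drop j (map sum_list bs) \<noteq> []" using j' by auto
            show "set (drop j (map sum_list bs)) \<subseteq> SS" using sS set_drop_subset by fast
            show "slope Z a = slope Z (sum_list (hd bs))" if "a \<in> set (drop j (map sum_list bs))" for a
              by (rule eq[OF in_set_dropD[OF that]])
          qed
          ultimately show ?thesis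
            using cut_slope_wedge(3)[OF Z sS j'] by (simp add: pre_eq post_eq sum_s)
        qed
        then show False using False by blast
      qed
      moreover have "split_weight u v bs = 0"
        unfolding split_weight_eq_prod m_def[symmetric] first if_not_P[OF False] by simp
      ultimately show ?thesis by (simp add: unit_integral_def)
    next
      case True
      have pre0: "wedge Z (pre j) \<gamma> = 0" if "j \<le> m" for j
      proof -
        have "j = 0 \<or> j = m \<or> j \<in> {1..<m}" using that by auto
        then consider "j = 0" | "j = m" | "j \<in> {1..<m}" by blast
        then show ?thesis
        proof cases
          case 1
          then show ?thesis by (simp add: pre_def wedge_zero_left[OF Z])
        next
          case 2
          then show ?thesis by (simp add: pre_def m_def cat \<gamma>_def)
        next
          case 3
          then show ?thesis using True by blast
        qed
      qed
      have slope_block: "slope Z (sum_list (bs ! j)) = slope Z \<gamma>" if j: "j < m" for j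
      proof -
        have "pre (Suc j) = pre j + sum_list (bs ! j)"
          using j by (simp add: pre_def m_def take_Suc_conv_app_nth)
        then have "wedge Z (sum_list (bs ! j)) \<gamma> = 0"
          using pre0[of j] pre0[of "Suc j"] j by (simp add: wedge_add_left[OF Z])
        moreover have "sum_list (bs ! j) \<in> SS" using j sS by (auto simp: m_def)
        ultimately show ?thesis using \<gamma> by (simp add: slope_eq_iff[OF Z])
      qed
      then have "\<forall>a\<in>set (map sum_list bs). slope Z a = slope Z \<gamma>"
        by (auto simp: in_set_conv_nth m_def)
      then have log: "log_coll Z (map sum_list bs) = (- 1) ^ (m - 1) / of_nat m"
        by (simp add: log_coll_def m_def)
      have block: "(\<Prod>k = 1..<length (bs ! j).
          v (concat (take j bs) @ take k (bs ! j)) (drop k (bs ! j) @ concat (drop (Suc j) bs))) =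
          [:stable_coll Z t (bs ! j):]" if j: "j < m" for j
      proof -
        let ?b = "bs ! j"
        have b: "set ?b \<subseteq> SS" using j bS(1)[of ?b] by (simp add: m_def)
        have "v (concat (take j bs) @ take k ?b) (drop k ?b @ concat (drop (Suc j) bs)) =
            [:c (sum_list (take k ?b)) (sum_list (drop k ?b)):]" if k: "k \<in> {1..<length ?b}" for k
        proof -
          let ?x = "sum_list (take k ?b)"
          let ?p = "concat (take j bs) @ take k ?b"
          let ?q = "drop k ?b @ concat (drop (Suc j) bs)"
          \<comment> \<open>The position \<open>k\<close> of the \<open>j\<close>-th block, seen as a position of \<open>\<alpha>\<close>: the prefixes before the block have height \<open>0\<close>.\<close>
          have pq: "?p @ ?q = \<alpha>"
            using j by (simp add: cat[symmetric] m_def) (metis append.assoc append_take_drop_id concat.simps(2) concat_append id_take_nth_drop)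
          have "take (length ?p) \<alpha> = ?p" "drop (length ?p) \<alpha> = ?q"
            using append_eq_conv_conj[THEN iffD1, OF pq] by (simp_all only: conj_absorb)
          moreover have "length ?p \<in> {1..<length \<alpha>}"
            using k unfolding pq[symmetric] by auto
          ultimately have "slope Z (sum_list ?p) > slope Z (sum_list ?q) \<longleftrightarrow>
              wedge Z (sum_list ?p) \<gamma> > 0"
            using cut_slope_wedge(1)[OF Z S, of "length ?p"] by (simp add: \<gamma>_def)
          also have "wedge Z (sum_list ?p) \<gamma> = wedge Z ?x \<gamma>"
            using pre0[of j] j by (simp add: wedge_add_left[OF Z] pre_def)
          also have "wedge Z ?x \<gamma> > 0 \<longleftrightarrow> slope Z ?x > slope Z \<gamma>"
            using take_drop_SS(1)[OF b k] \<gamma> by (simp add: slope_greater_iff[OF Z])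
          also have "\<dots> \<longleftrightarrow> slope Z ?x > slope Z (sum_list ?b)"
            using slope_block[OF j] by simp
          also have "\<dots> \<longleftrightarrow> wedge Z ?x (sum_list ?b) > 0"
          proof -
            have "sum_list ?b \<in> SS" using j sS by (auto simp: m_def)
            then show ?thesis using take_drop_SS(1)[OF b k] by (simp add: slope_greater_iff[OF Z])
          qed
          also have "\<dots> \<longleftrightarrow> slope Z ?x > slope Z (sum_list (drop k ?b))"
            by (rule cut_slope_wedge(1)[OF Z b k, symmetric])
          finally show ?thesis by (simp add: v_def c_def)
        qed
        then have "(\<Prod>k = 1..<length ?b.
            v (concat (take j bs) @ take k ?b) (drop k ?b @ concat (drop (Suc j) bs))) =
            (\<Prod>k = 1..<length ?b. [:c (sum_list (take k ?b)) (sum_list (drop k ?b)):])"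
          by (intro prod.cong refl) blast
        also have "\<dots> = [:stable_coll Z t ?b:]"
          unfolding stable_coll_def cut_prod_def c_def by (rule prod_const_poly)
        finally show ?thesis .
      qed
      have "split_weight u v bs =
          monom ((- 1) ^ (m - 1)) (m - 1) * (\<Prod>j<m. [:stable_coll Z t (bs ! j):])"
        unfolding split_weight_eq_prod using first True block by (simp add: m_def)
      also have "(\<Prod>j<m. [:stable_coll Z t (bs ! j):]) = [:prod_list (map (stable_coll Z t) bs):]"
        by (simp add: prod_const_poly prod_list_conv_prod m_def)
      finally have weight: "split_weight u v bs =
          smult (prod_list (map (stable_coll Z t) bs)) (monom ((- 1) ^ (m - 1)) (m - 1))"
        by simp
      have "unit_integral N (monom ((- 1) ^ (m - 1)) (m - 1)) = (- 1) ^ (m - 1) / of_nat m"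
        using unit_integral_monom[OF mN] m by simp
      then show ?thesis unfolding log weight unit_integral_smult by simp
    qed
  qed
  have "comp_coll (log_coll Z) (stable_coll Z t) \<alpha> =
      unit_integral N (\<Sum>bs\<in>splits \<alpha>. split_weight u v bs)"
    unfolding comp_coll_def unit_integral_sum by (intro sum.cong refl summand)
  also have "(\<Sum>bs\<in>splits \<alpha>. split_weight u v bs) = (\<Prod>k = 1..<length \<alpha>.
      if slope Z (sum_list (take k \<alpha>)) > slope Z (sum_list (drop k \<alpha>)) then [:t - 1:]
      else if slope Z (sum_list (take k \<alpha>)) < slope Z (sum_list (drop k \<alpha>)) then [:t:]
      else [:t, -1:])"
    unfolding sum_split_weight[OF ne] by (intro prod.cong) (auto simp: u_def v_def c_def)
  also have "\<dots> = [:t - 1:] ^ count_cuts (\<lambda>a b. slope Z a > slope Z b) \<alpha> *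
      [:t:] ^ count_cuts (\<lambda>a b. slope Z a < slope Z b) \<alpha> *
      [:t, -1:] ^ count_cuts (\<lambda>a b. slope Z a = slope Z b) \<alpha>"
    unfolding count_cuts_eq by (rule prod_three_cases) auto
  also have "unit_integral N \<dots> = g_charge Z t \<alpha>"
  proof -
    have "count_cuts (\<lambda>a b. slope Z a = slope Z b) \<alpha> \<le> card {1..<length \<alpha>}"
      unfolding count_cuts_eq by (intro card_mono) auto
    then have "count_cuts (\<lambda>a b. slope Z a = slope Z b) \<alpha> < N"
      using ne by (cases \<alpha>) (auto simp: N_def)
    then show ?thesis
      by (simp add: poly_const_pow unit_integral_smult unit_integral_power g_charge_def g_value_def)
  qed
  finally show ?thesis .
qed


section \<open>Averaging over rotations\<close>

text \<open>The value of \<open>g_value\<close> for the walk that starts at height \<open>f k\<close> and visits the heights \<open>f j\<close>. The start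
  itself is among the \<open>j\<close> with \<open>f j = f k\<close>, which accounts for the \<open>n\<^sub>0 + 1\<close> in \<open>g_value\<close>.\<close>

definition rank_weight :: "rat \<Rightarrow> ('i \<Rightarrow> 'b :: linorder) \<Rightarrow> 'i set \<Rightarrow> 'i \<Rightarrow> rat" where
  "rank_weight t f K k =
     t ^ card {j \<in> K. f j < f k} * (t - 1) ^ card {j \<in> K. f k < f j} *
     ((t ^ card {j \<in> K. f j = f k} - (t - 1) ^ card {j \<in> K. f j = f k}) /
       of_nat (card {j \<in> K. f j = f k}))"

text \<open>A level with \<open>c\<close> elements and \<open>b\<close> elements below it contributes
  \<open>t\<^bsup>b+c\<^esup>(t - 1)\<^bsup>m-b-c\<^esup> - t\<^bsup>b\<^esup>(t - 1)\<^bsup>m-b\<^esup>\<close>, where \<open>m = card K\<close>, and these differences telescope over the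
  levels. The proof removes the top level.\<close>

lemma sum_rank_weight:
  "finite K \<Longrightarrow> (\<Sum>k\<in>K. rank_weight t f K k) = t ^ card K - (t - 1) ^ card K"
proof (induction "card K" arbitrary: K rule: less_induct)
  case less
  show ?case
  proof (cases "K = {}")
    case False
    define M where "M = Max (f ` K)"
    define T where "T = {k \<in> K. f k = M}"
    define K' where "K' = {k \<in> K. f k < M}"
    have le: "f k \<le> M" if "k \<in> K" for k
      using that less.prems by (simp add: M_def)
    have "M \<in> f ` K" unfolding M_def using less.prems False by (intro Max_in) auto
    then have T: "T \<noteq> {}" by (auto simp: T_def)
    have K: "K = K' \<union> T" "K' \<inter> T = {}" using le by (auto simp: K'_def T_def order_less_le)
    have fin: "finite K'" "finite T" using less.prems by (auto simp: K'_def T_def)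
    have card: "card K = card K' + card T" using K fin by (metis card_Un_disjoint)
    have cardT: "0 < card T" using T fin by (simp add: card_gt_0_iff)
    have top: "rank_weight t f K k = t ^ card K' * (t ^ card T - (t - 1) ^ card T) / of_nat (card T)"
      if "k \<in> T" for k
    proof -
      have "{j \<in> K. f j < f k} = K'" "{j \<in> K. f k < f j} = {}" "{j \<in> K. f j = f k} = T"
        using that le by (auto simp: K'_def T_def not_less)
      then show ?thesis by (simp only: rank_weight_def) simp
    qed
    have low: "rank_weight t f K k = (t - 1) ^ card T * rank_weight t f K' k" if k: "k \<in> K'" for k
    proof -
      have "f j < M \<or> f j = M" if "j \<in> K" for j using le[OF that] by auto
      then have "{j \<in> K. f j < f k} = {j \<in> K'. f j < f k}"
        "{j \<in> K. f j = f k} = {j \<in> K'. f j = f k}"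
        "{j \<in> K. f k < f j} = {j \<in> K'. f k < f j} \<union> T"
        using k by (auto simp: K'_def T_def)
      moreover have "card ({j \<in> K'. f k < f j} \<union> T) = card {j \<in> K'. f k < f j} + card T"
        using fin K(2) by (intro card_Un_disjoint) auto
      ultimately show ?thesis by (simp add: rank_weight_def power_add)
    qed
    have "(\<Sum>k\<in>K. rank_weight t f K k) =
        (\<Sum>k\<in>K'. rank_weight t f K k) + (\<Sum>k\<in>T. rank_weight t f K k)"
      using sum.union_disjoint[OF fin K(2)] K(1) by simp
    also have "\<dots> = (t - 1) ^ card T * (t ^ card K' - (t - 1) ^ card K') +
        t ^ card K' * (t ^ card T - (t - 1) ^ card T)"
      using less.hyps[of K'] card cardT fin by (simp add: low top flip: sum_distrib_left)
    also have "\<dots> = t ^ card K - (t - 1) ^ card K"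
      by (simp add: card power_add algebra_simps)
    finally show ?thesis .
  qed simp
qed

text \<open>Here \<open>f\<close> is a perturbation of \<open>P\<close> that may split the levels of \<open>P\<close> but does not interchange them. Then
  elements outside the level of \<open>k0\<close> stay on the same side, and on the level itself \<open>sum_rank_weight\<close>
  shows that the total does not depend on how it is split.\<close>

lemma sum_rank_weight_level:
  fixes P :: "'i \<Rightarrow> 'b :: linorder" and f :: "'i \<Rightarrow> 'c :: linorder"
  assumes fin: "finite K" and k0: "k0 \<in> K"
    and refine: "\<And>j k. j \<in> K \<Longrightarrow> k \<in> K \<Longrightarrow> P j < P k \<Longrightarrow> f j < f k"
  shows "(\<Sum>k | k \<in> K \<and> P k = P k0. rank_weight t f K k) =
    of_nat (card {k \<in> K. P k = P k0}) * rank_weight t P K k0"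
proof -
  let ?E = "{k \<in> K. P k = P k0}"
  let ?w = "t ^ card {j \<in> K. P j < P k0} * (t - 1) ^ card {j \<in> K. P k0 < P j}"
  have "rank_weight t f K k = ?w * rank_weight t f ?E k" if k: "k \<in> ?E" for k
  proof -
    have less: "f j < f k" if "j \<in> K" "P j < P k0" for j using refine[of j k] that k by simp
    have greater: "f k < f j" if "j \<in> K" "P k0 < P j" for j using refine[of k j] that k by simp
    have "{j \<in> K. f j < f k} = {j \<in> K. P j < P k0} \<union> {j \<in> ?E. f j < f k}"
      using less greater by (auto) (metis less_asym less_linear)
    moreover have "card ({j \<in> K. P j < P k0} \<union> {j \<in> ?E. f j < f k}) =
        card {j \<in> K. P j < P k0} + card {j \<in> ?E. f j < f k}"
      using fin by (intro card_Un_disjoint) auto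
    moreover have "{j \<in> K. f k < f j} = {j \<in> K. P k0 < P j} \<union> {j \<in> ?E. f k < f j}"
      using less greater by (auto) (metis less_asym less_linear)
    moreover have "card ({j \<in> K. P k0 < P j} \<union> {j \<in> ?E. f k < f j}) =
        card {j \<in> K. P k0 < P j} + card {j \<in> ?E. f k < f j}"
      using fin by (intro card_Un_disjoint) auto
    moreover have "{j \<in> K. f j = f k} = {j \<in> ?E. f j = f k}"
      using less greater by (auto) (metis less_irrefl less_linear)
    ultimately show ?thesis by (simp only: rank_weight_def power_add) (simp only: ac_simps)
  qed
  then have "(\<Sum>k\<in>?E. rank_weight t f K k) = ?w * (\<Sum>k\<in>?E. rank_weight t f ?E k)"
    by (simp add: sum_distrib_left)
  also have "(\<Sum>k\<in>?E. rank_weight t f ?E k) = t ^ card ?E - (t - 1) ^ card ?E"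
    using fin by (intro sum_rank_weight) auto
  also have "?w * \<dots> = of_nat (card ?E) * rank_weight t P K k0"
  proof -
    have "card ?E \<noteq> 0" using fin k0 by auto
    then show ?thesis by (simp add: rank_weight_def)
  qed
  finally show ?thesis by simp
qed

text \<open>Rotating a closed walk shifts all its heights by the height of the new starting point.\<close>

lemma height_rotate:
  fixes h :: "'v :: ab_group_add \<Rightarrow> 'c :: ab_group_add"
  assumes add: "\<And>x y. h (x + y) = h x + h y" and zero: "h (sum_list \<alpha>) = 0"
    and k: "k < length \<alpha>" and i: "i < length \<alpha>"
  shows "h (sum_list (take i (rotate k \<alpha>))) =
    h (sum_list (take ((k + i) mod length \<alpha>) \<alpha>)) - h (sum_list (take k \<alpha>))"
proof -
  have h0: "h 0 = 0" using add[of 0 0] by simp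
  have rot: "rotate k \<alpha> = drop k \<alpha> @ take k \<alpha>" using k by (simp add: rotate_drop_take)
  have cat: "h (sum_list (xs @ ys)) = h (sum_list xs) + h (sum_list ys)" for xs ys
    by (simp add: add)
  show ?thesis
  proof (cases "k + i < length \<alpha>")
    case True
    have "take k \<alpha> @ take i (drop k \<alpha>) = take (k + i) \<alpha>" by (simp add: take_add)
    then show ?thesis using True cat[of "take k \<alpha>" "take i (drop k \<alpha>)"] by (simp add: rot)
  next
    case False
    then have "(k + i) mod length \<alpha> = k + i - length \<alpha>"
      using k i by (simp add: mod_if)
    moreover have "take i (rotate k \<alpha>) = drop k \<alpha> @ take (k + i - length \<alpha>) \<alpha>"
    proof -
      have "i - (length \<alpha> - k) = k + i - length \<alpha>" "k + i - length \<alpha> \<le> k"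
        using False k i by auto
      then show ?thesis using False k by (simp add: rot min_absorb1)
    qed
    moreover have "h (sum_list (drop k \<alpha>)) = - h (sum_list (take k \<alpha>))"
      using cat[of "take k \<alpha>" "drop k \<alpha>"] zero by (simp add: eq_neg_iff_add_eq_0 add.commute)
    ultimately show ?thesis by (simp add: add)
  qed
qed

lemma card_height_rotate:
  fixes h :: "'v :: ab_group_add \<Rightarrow> 'c :: ab_group_add"
  assumes add: "\<And>x y. h (x + y) = h x + h y" and zero: "h (sum_list \<alpha>) = 0"
    and k: "k < length \<alpha>"
  shows "card {i \<in> {..<length \<alpha>}. Q (h (sum_list (take i (rotate k \<alpha>))))} =
    card {j \<in> {..<length \<alpha>}. Q (h (sum_list (take j \<alpha>)) - h (sum_list (take k \<alpha>)))}"
proof -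
  let ?n = "length \<alpha>"
  have n: "0 < ?n" using k by auto
  have inv1: "(k + (j + (?n - k)) mod ?n) mod ?n = j" if "j < ?n" for j
  proof -
    have "(k + (j + (?n - k)) mod ?n) mod ?n = (k + (j + (?n - k))) mod ?n" by (simp add: mod_simps)
    also have "k + (j + (?n - k)) = j + ?n" using k by simp
    finally show ?thesis using that by simp
  qed
  have inv2: "((k + i) mod ?n + (?n - k)) mod ?n = i" if "i < ?n" for i
  proof -
    have "((k + i) mod ?n + (?n - k)) mod ?n = ((k + i) + (?n - k)) mod ?n" by (simp add: mod_simps)
    also have "(k + i) + (?n - k) = i + ?n" using k by simp
    finally show ?thesis using that by simp
  qed
  show ?thesis
    by (rule bij_betw_same_card[of "\<lambda>i. (k + i) mod ?n"],
        rule bij_betw_byWitness[where f' = "\<lambda>j. (j + (?n - k)) mod ?n"])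
      (use n inv1 inv2 height_rotate[where h = h, OF add zero k] in \<open>auto\<close>)
qed

lemma card_from_1:
  fixes n :: nat
  assumes "0 < n"
  shows "card {i \<in> {..<n}. Q i} = (if Q 0 then 1 else 0) + card {i \<in> {1..<n}. Q i}"
proof -
  have "{i \<in> {..<n}. Q i} = (if Q 0 then insert 0 {i \<in> {1..<n}. Q i} else {i \<in> {1..<n}. Q i})"
    using assms by (auto simp: Suc_le_eq intro: Nat.gr0I)
  moreover have "card (insert 0 {i \<in> {1..<n}. Q i}) = 1 + card {i \<in> {1..<n}. Q i}"
    by (subst card_insert_disjoint) auto
  ultimately show ?thesis by (simp only: if_distrib[of card]) simp
qed

lemma g_charge_rotate:
  assumes Z: "central_charge Z" and S: "set \<alpha> \<subseteq> SS" and k: "k < length \<alpha>"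
  shows "g_charge Z t (rotate k \<alpha>) =
    rank_weight t (\<lambda>j. wedge Z (sum_list (take j \<alpha>)) (sum_list \<alpha>)) {..<length \<alpha>} k"
proof -
  let ?\<gamma> = "sum_list \<alpha>" and ?n = "length \<alpha>"
  let ?f = "\<lambda>j. wedge Z (sum_list (take j \<alpha>)) ?\<gamma>"
  let ?r = "\<lambda>j. wedge Z (sum_list (take j (rotate k \<alpha>))) ?\<gamma>"
  have sum_rot: "sum_list (rotate k \<alpha>) = ?\<gamma>"
    using k sum_list_take_drop[of k \<alpha>] by (simp add: rotate_drop_take add.commute)
  have cuts: "slope Z (sum_list (take i (rotate k \<alpha>))) > slope Z (sum_list (drop i (rotate k \<alpha>)))
        \<longleftrightarrow> ?r i > 0"
      "slope Z (sum_list (take i (rotate k \<alpha>))) < slope Z (sum_list (drop i (rotate k \<alpha>)))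
        \<longleftrightarrow> ?r i < 0"
      "slope Z (sum_list (take i (rotate k \<alpha>))) = slope Z (sum_list (drop i (rotate k \<alpha>)))
        \<longleftrightarrow> ?r i = 0"
    if "i \<in> {1..<?n}" for i
    using cut_slope_wedge[OF Z, of "rotate k \<alpha>" i] that S by (simp_all add: sum_rot)
  have n: "0 < ?n" using k by auto
  have r0: "?r 0 = 0" by (simp add: wedge_zero_left[OF Z])
  have card: "card {i \<in> {..<?n}. Q (?r i)} = card {j \<in> {..<?n}. Q (?f j - ?f k)}" for Q
    using k by (intro card_height_rotate wedge_add_left[OF Z]) auto
  have "count_cuts (\<lambda>a b. slope Z a > slope Z b) (rotate k \<alpha>) = card {i \<in> {1..<?n}. ?r i > 0}"
    unfolding count_cuts_eq using cuts(1) by (intro arg_cong[of _ _ card]) auto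
  also have "\<dots> = card {j \<in> {..<?n}. ?f k < ?f j}"
    using card_from_1[OF n, of "\<lambda>i. ?r i > 0"] card[of "\<lambda>x. x > 0"] r0 by simp
  finally have c1: "count_cuts (\<lambda>a b. slope Z a > slope Z b) (rotate k \<alpha>) = \<dots>" .
  have "count_cuts (\<lambda>a b. slope Z a < slope Z b) (rotate k \<alpha>) = card {i \<in> {1..<?n}. ?r i < 0}"
    unfolding count_cuts_eq using cuts(2) by (intro arg_cong[of _ _ card]) auto
  also have "\<dots> = card {j \<in> {..<?n}. ?f j < ?f k}"
    using card_from_1[OF n, of "\<lambda>i. ?r i < 0"] card[of "\<lambda>x. x < 0"] r0 by simp
  finally have c2: "count_cuts (\<lambda>a b. slope Z a < slope Z b) (rotate k \<alpha>) = \<dots>" .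
  have "count_cuts (\<lambda>a b. slope Z a = slope Z b) (rotate k \<alpha>) = card {i \<in> {1..<?n}. ?r i = 0}"
    unfolding count_cuts_eq using cuts(3) by (intro arg_cong[of _ _ card]) auto
  also have "\<dots> + 1 = card {j \<in> {..<?n}. ?f j = ?f k}"
    using card_from_1[OF n, of "\<lambda>i. ?r i = 0"] card[of "\<lambda>x. x = 0"] r0 by simp
  finally have c3: "count_cuts (\<lambda>a b. slope Z a = slope Z b) (rotate k \<alpha>) + 1 = \<dots>" .
  show ?thesis
    unfolding g_charge_def g_value_def rank_weight_def c1 c2 c3 ..
qed

lemma skew_form_add:
  assumes "skew_form B"
  shows "B (x + y) z = B x z + B y z" "B z (x + y) = B z x + B z y"
proof -
  have "additive (\<lambda>x. B x z)" "additive (B z)" using assms unfolding skew_form_def by blast+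
  then show "B (x + y) z = B x z + B y z" "B z (x + y) = B z x + B z y"
    by (simp_all only: additive_def)
qed

lemma skew_form_self:
  assumes "skew_form B"
  shows "B x x = 0"
proof -
  have "B x x = - B x x" using assms unfolding skew_form_def by blast
  then show ?thesis by linarith
qed

lemma skew_form_zero:
  assumes "skew_form B"
  shows "B 0 x = 0"
  using skew_form_add(1)[OF assms, of 0 0 x] by simp

lemma cut_skew_form:
  assumes "skew_form B"
  shows "B (sum_list (take k \<alpha>)) (sum_list (drop k \<alpha>)) = B (sum_list (take k \<alpha>)) (sum_list \<alpha>)"
proof -
  have "B (sum_list (take k \<alpha>)) (sum_list (take k \<alpha>) + sum_list (drop k \<alpha>)) =
      B (sum_list (take k \<alpha>)) (sum_list (drop k \<alpha>))"
    by (simp only: skew_form_add(2)[OF assms] skew_form_self[OF assms] add_0)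
  then show ?thesis by (simp only: sum_list_take_drop)
qed

lemma g_attr_eq_rank_weight:
  assumes B: "skew_form B" and "\<alpha> \<noteq> []"
  shows "g_attr B t \<alpha> =
    rank_weight t (\<lambda>j. B (sum_list (take j \<alpha>)) (sum_list \<alpha>)) {..<length \<alpha>} 0"
proof -
  let ?P = "\<lambda>j. B (sum_list (take j \<alpha>)) (sum_list \<alpha>)"
  have n: "0 < length \<alpha>" using assms(2) by simp
  have P0: "?P 0 = 0" by (simp add: skew_form_zero[OF B])
  show ?thesis
    unfolding g_attr_def g_value_def rank_weight_def P0 count_cuts_eq cut_skew_form[OF B]
      card_from_1[OF n] by simp
qed

text \<open>The summands are rank weights of the perturbed heights by \<open>g_charge_rotate\<close>, and \<open>g\<^sub>*\<close> is a rank weight of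
  the unperturbed ones; \<open>near\<close> says that the perturbation preserves strict inequalities.\<close>

lemma average_g_charge_rotations:
  assumes B: "skew_form B" and Z: "central_charge Z" and S: "set \<alpha> \<subseteq> SS" and ne: "\<alpha> \<noteq> []"
    and near: "\<And>j k. j < length \<alpha> \<Longrightarrow> k < length \<alpha> \<Longrightarrow>
        B (sum_list (take j \<alpha>)) (sum_list \<alpha>) < B (sum_list (take k \<alpha>)) (sum_list \<alpha>) \<Longrightarrow>
        wedge Z (sum_list (take j \<alpha>)) (sum_list \<alpha>) < wedge Z (sum_list (take k \<alpha>)) (sum_list \<alpha>)"
  shows "(\<Sum>k | k < length \<alpha> \<and> B (sum_list (take k \<alpha>)) (sum_list \<alpha>) = 0. g_charge Z t (rotate k \<alpha>)) =
    of_nat (card {k. k < length \<alpha> \<and> B (sum_list (take k \<alpha>)) (sum_list \<alpha>) = 0}) * g_attr B t \<alpha>"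
proof -
  let ?P = "\<lambda>j. B (sum_list (take j \<alpha>)) (sum_list \<alpha>)"
  have "?P 0 = 0" by (simp add: skew_form_zero[OF B])
  then show ?thesis
    using sum_rank_weight_level[of "{..<length \<alpha>}" 0 ?P
        "\<lambda>j. wedge Z (sum_list (take j \<alpha>)) (sum_list \<alpha>)" t] near ne
    by (simp add: g_charge_rotate[OF Z S] g_attr_eq_rank_weight[OF B])
qed

context graded_rat_algebra
begin

text \<open>If \<open>\<langle>\<alpha>\<^sub>\<le>\<^sub>k, \<gamma>\<rangle> = 0\<close>, then the two halves of the product \<open>C(\<alpha>\<^sub>1)\<dots>C(\<alpha>\<^sub>n)\<close> at \<open>k\<close> commute, so rotating \<open>\<alpha>\<close> at
  \<open>k\<close> does not change it. The coefficients may therefore be averaged over these rotations. Formally, both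
  sides are sums over pairs of a sequence \<open>\<alpha>\<close> and a zero \<open>k\<close> of its walk, weighted by the inverse of the
  number of zeros, and rotating \<open>\<alpha>\<close> at \<open>k\<close> is an involution on such pairs.\<close>

lemma act_g_charge_near_attractor:
  assumes B: "skew_form B" and Z: "central_charge Z"
    and comm: "\<And>\<gamma> \<gamma>' x y. \<gamma> \<in> NN \<Longrightarrow> \<gamma>' \<in> NN \<Longrightarrow> B \<gamma> \<gamma>' = 0 \<Longrightarrow>
      x \<in> R \<gamma> \<Longrightarrow> y \<in> R \<gamma>' \<Longrightarrow> x * y = y * x"
    and C: "\<And>a. a \<in> SS \<Longrightarrow> C a \<in> R a"
    and near: "\<And>\<alpha> j k. \<alpha> \<in> decomps \<gamma> \<Longrightarrow> j < length \<alpha> \<Longrightarrow> k < length \<alpha> \<Longrightarrow>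
        B (sum_list (take j \<alpha>)) \<gamma> < B (sum_list (take k \<alpha>)) \<gamma> \<Longrightarrow>
        wedge Z (sum_list (take j \<alpha>)) \<gamma> < wedge Z (sum_list (take k \<alpha>)) \<gamma>"
  shows "act smul (g_charge Z t) C \<gamma> = act smul (g_attr B t) C \<gamma>"
proof -
  define zeros where "zeros \<alpha> = {k. k < length \<alpha> \<and> B (sum_list (take k \<alpha>)) \<gamma> = 0}" for \<alpha>
  define pr where "pr \<alpha> = prod_list (map C \<alpha>)" for \<alpha>
  define f where "f \<alpha> = smul (g_charge Z t \<alpha> / of_nat (card (zeros \<alpha>))) (pr \<alpha>)" for \<alpha>
  have D: "set \<alpha> \<subseteq> SS" "\<alpha> \<noteq> []" "sum_list \<alpha> = \<gamma>" if "\<alpha> \<in> decomps \<gamma>" for \<alpha>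
    using that by (auto simp: decomps_def)
  have fin: "finite (zeros \<alpha>)" for \<alpha> by (simp add: zeros_def)
  have zero_in: "0 \<in> zeros \<alpha>" if "\<alpha> \<in> decomps \<gamma>" for \<alpha>
    using D[OF that] by (simp add: zeros_def skew_form_zero[OF B])
  have card0: "card (zeros \<alpha>) \<noteq> 0" if "\<alpha> \<in> decomps \<gamma>" for \<alpha>
    using zero_in[OF that] fin by auto
  have rot_D: "rotate k \<alpha> \<in> decomps \<gamma>" if "\<alpha> \<in> decomps \<gamma>" "k \<in> zeros \<alpha>" for \<alpha> k
    using that sum_list_take_drop[of k \<alpha>]
    by (auto simp: decomps_def zeros_def) (simp add: rotate_drop_take add.commute)
  have B\<gamma>: "B \<gamma> \<gamma> = 0" by (rule skew_form_self[OF B])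
  have rot_zeros: "card (zeros (rotate k \<alpha>)) = card (zeros \<alpha>)"
    if \<alpha>: "\<alpha> \<in> decomps \<gamma>" and k: "k \<in> zeros \<alpha>" for \<alpha> k
    using card_height_rotate[of "\<lambda>x. B x \<gamma>" \<alpha> k "\<lambda>x. x = 0"] D[OF \<alpha>] k B\<gamma>
    by (simp add: zeros_def skew_form_add[OF B])
  have rot_back: "rotate ((length \<alpha> - k) mod length \<alpha>) (rotate k \<alpha>) = \<alpha>"
    if k: "k \<in> zeros \<alpha>" for \<alpha> k
  proof -
    have "rotate ((length \<alpha> - k) mod length \<alpha>) (rotate k \<alpha>) = rotate (length \<alpha> - k) (rotate k \<alpha>)"
      using rotate_conv_mod[of "length \<alpha> - k" "rotate k \<alpha>"] by simp
    also have "\<dots> = rotate (length \<alpha>) \<alpha>" using k by (simp add: rotate_rotate zeros_def)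
    finally show ?thesis by (simp add: rotate_conv_mod[of "length \<alpha>"])
  qed
  have back_zero: "(length \<alpha> - k) mod length \<alpha> \<in> zeros (rotate k \<alpha>)"
    if \<alpha>: "\<alpha> \<in> decomps \<gamma>" and k: "k \<in> zeros \<alpha>" for \<alpha> k
  proof -
    have n: "k < length \<alpha>" using k by (simp add: zeros_def)
    have "B (sum_list (take ((length \<alpha> - k) mod length \<alpha>) (rotate k \<alpha>))) \<gamma> =
        B (sum_list (take ((k + (length \<alpha> - k) mod length \<alpha>) mod length \<alpha>) \<alpha>)) \<gamma>
        - B (sum_list (take k \<alpha>)) \<gamma>"
      using D[OF \<alpha>] n B\<gamma>
      by (intro height_rotate[where h = "\<lambda>x. B x \<gamma>"]) (auto simp: skew_form_add[OF B])
    also have "(k + (length \<alpha> - k) mod length \<alpha>) mod length \<alpha> = 0"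
      using n by (simp add: mod_simps)
    finally have "B (sum_list (take ((length \<alpha> - k) mod length \<alpha>) (rotate k \<alpha>))) \<gamma> = 0"
      using k by (simp add: zeros_def skew_form_zero[OF B])
    moreover have "(length \<alpha> - k) mod length \<alpha> < length \<alpha>"
      using n by (intro mod_less_divisor) auto
    ultimately show ?thesis by (simp add: zeros_def)
  qed
  have back_back: "(length \<alpha> - (length \<alpha> - k) mod length \<alpha>) mod length \<alpha> = k"
    if k: "k \<in> zeros \<alpha>" for \<alpha> k
    using k by (cases "k = 0") (auto simp: zeros_def)
  have pr_rotate: "pr (rotate k \<alpha>) = pr \<alpha>" if \<alpha>: "\<alpha> \<in> decomps \<gamma>" and k: "k \<in> zeros \<alpha>" for \<alpha> k
  proof -
    let ?x = "take k \<alpha>" and ?y = "drop k \<alpha>"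
    have S: "set ?x \<subseteq> SS" "set ?y \<subseteq> SS"
      using D(1)[OF \<alpha>] by (auto dest: in_set_takeD in_set_dropD)
    have "pr ?x * pr ?y = pr ?y * pr ?x"
    proof (rule comm)
      show "sum_list ?x \<in> NN" "sum_list ?y \<in> NN" using S total_sum_list by blast+
      show "B (sum_list ?x) (sum_list ?y) = 0"
        using k D(3)[OF \<alpha>] by (simp add: cut_skew_form[OF B] zeros_def)
      show "pr ?x \<in> R (sum_list ?x)" "pr ?y \<in> R (sum_list ?y)"
        unfolding pr_def using S C by (auto intro: prod_list_component)
    qed
    moreover have "pr (rotate k \<alpha>) = pr ?y * pr ?x"
      using k by (simp add: rotate_drop_take pr_def zeros_def)
    moreover have "pr ?x * pr ?y = pr \<alpha>"
      unfolding pr_def by (metis append_take_drop_id map_append prod_list.append)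
    ultimately show ?thesis by simp
  qed
  have "act smul (g_charge Z t) C \<gamma> = (\<Sum>\<alpha>\<in>decomps \<gamma>. \<Sum>k\<in>zeros \<alpha>. f \<alpha>)"
  proof -
    have "(\<Sum>k\<in>zeros \<alpha>. f \<alpha>) = smul (g_charge Z t \<alpha>) (pr \<alpha>)" if "\<alpha> \<in> decomps \<gamma>" for \<alpha>
    proof -
      have "(\<Sum>k\<in>zeros \<alpha>. f \<alpha>) =
          smul (\<Sum>k\<in>zeros \<alpha>. g_charge Z t \<alpha> / of_nat (card (zeros \<alpha>))) (pr \<alpha>)"
        unfolding f_def scale_sum_left ..
      then show ?thesis using card0[OF that] by simp
    qed
    then show ?thesis by (simp add: act_def pr_def)
  qed
  also have "\<dots> = (\<Sum>(\<alpha>, k)\<in>Sigma (decomps \<gamma>) zeros. f \<alpha>)"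
    using fin finite_decomps by (intro sum.Sigma) auto
  also have "\<dots> = (\<Sum>(\<alpha>, k)\<in>Sigma (decomps \<gamma>) zeros. f (rotate k \<alpha>))"
  proof -
    \<comment> \<open>\<open>rotate k\<close> is undone by the rotation by \<open>n - k\<close>; the remainder keeps \<open>k = 0\<close> in range.\<close>
    define \<phi> where "\<phi> = (\<lambda>(\<alpha> :: (int ^ 'r) list, k). (rotate k \<alpha>, (length \<alpha> - k) mod length \<alpha>))"
    have in_Sigma: "\<phi> x \<in> Sigma (decomps \<gamma>) zeros" if "x \<in> Sigma (decomps \<gamma>) zeros" for x
      using that rot_D back_zero by (auto simp: \<phi>_def split: prod.splits)
    have invol: "\<phi> (\<phi> x) = x" if x_in: "x \<in> Sigma (decomps \<gamma>) zeros" for x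
    proof -
      obtain \<alpha> k where x: "x = (\<alpha>, k)" "k \<in> zeros \<alpha>" using x_in by (cases x) auto
      then show ?thesis
        using rot_back[OF x(2)] back_back[OF x(2)] by (simp add: \<phi>_def)
    qed
    have back_f: "(case \<phi> x of (\<alpha>, k) \<Rightarrow> f (rotate k \<alpha>)) = (case x of (\<alpha>, k) \<Rightarrow> f \<alpha>)"
      if x_in: "x \<in> Sigma (decomps \<gamma>) zeros" for x
    proof -
      obtain \<alpha> k where x: "x = (\<alpha>, k)" "k \<in> zeros \<alpha>" using x_in by (cases x) auto
      then show ?thesis using rot_back[OF x(2)] by (simp add: \<phi>_def)
    qed
    show ?thesis
      by (rule sum.reindex_bij_witness[of _ \<phi> \<phi>]) (fact invol in_Sigma back_f)+
  qed
  also have "\<dots> = (\<Sum>\<alpha>\<in>decomps \<gamma>. \<Sum>k\<in>zeros \<alpha>. f (rotate k \<alpha>))"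
    using fin finite_decomps by (intro sum.Sigma[symmetric]) auto
  also have "\<dots> = act smul (g_attr B t) C \<gamma>"
    unfolding act_def
  proof (intro sum.cong refl)
    fix \<alpha> assume \<alpha>: "\<alpha> \<in> decomps \<gamma>"
    have "(\<Sum>k\<in>zeros \<alpha>. f (rotate k \<alpha>)) =
        (\<Sum>k\<in>zeros \<alpha>. smul (g_charge Z t (rotate k \<alpha>) / of_nat (card (zeros \<alpha>))) (pr \<alpha>))"
      unfolding f_def using \<alpha> by (intro sum.cong refl) (simp add: rot_zeros pr_rotate)
    also have "\<dots> = smul ((\<Sum>k\<in>zeros \<alpha>. g_charge Z t (rotate k \<alpha>)) / of_nat (card (zeros \<alpha>))) (pr \<alpha>)"
      by (simp only: scale_sum_left sum_divide_distrib)
    also have "(\<Sum>k\<in>zeros \<alpha>. g_charge Z t (rotate k \<alpha>)) = of_nat (card (zeros \<alpha>)) * g_attr B t \<alpha>"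
      using average_g_charge_rotations[OF B Z D(1,2)[OF \<alpha>]] near[OF \<alpha>]
      by (simp add: zeros_def D(3)[OF \<alpha>])
    finally show "(\<Sum>k\<in>zeros \<alpha>. f (rotate k \<alpha>)) = smul (g_attr B t \<alpha>) (prod_list (map C \<alpha>))"
      using card0[OF \<alpha>] by (simp add: pr_def)
  qed
  finally show ?thesis .
qed

end


section \<open>Stability parameters near the attractor point\<close>

lemma central_charge_charge_of:
  fixes \<theta> :: "real ^ 'r"
  shows "central_charge (charge_of \<theta>)"
proof -
  have "(\<Sum>i\<in>UNIV. (axis k 1 :: int ^ 'r) $ i) = 1" for k
    by (simp add: axis_def)
  then have "(\<Sum>i\<in>UNIV. real_of_int ((axis k 1 :: int ^ 'r) $ i)) = 1" for k
    by (simp flip: of_int_sum)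
  then show ?thesis
    by (auto simp: central_charge_def charge_of_def additive_def complex_eq_iff
        sum.distrib distrib_left)
qed

text \<open>At the attractor point itself the heights are positive multiples of \<open>\<langle>-,\<gamma>\<rangle>\<close>. Only finitely many partial
  sums occur for a given \<open>\<gamma>\<close>, and heights depend continuously on the stability parameter, so strict
  inequalities between them persist nearby.\<close>

lemma heights_near_attractor:
  assumes B: "skew_form B" and \<gamma>: "\<gamma> \<in> SS"
  shows "\<exists>\<epsilon>>0. \<forall>\<theta>'. dist \<theta>' (attractor_stability B \<gamma>) < \<epsilon> \<longrightarrow>
    (\<forall>\<alpha>\<in>decomps \<gamma>. \<forall>j k. j < length \<alpha> \<longrightarrow> k < length \<alpha> \<longrightarrow>
       B (sum_list (take j \<alpha>)) \<gamma> < B (sum_list (take k \<alpha>)) \<gamma> \<longrightarrow>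
       wedge (charge_of \<theta>') (sum_list (take j \<alpha>)) \<gamma> < wedge (charge_of \<theta>') (sum_list (take k \<alpha>)) \<gamma>)"
proof -
  let ?\<theta> = "attractor_stability B \<gamma>"
  define X where "X = (\<Union>\<alpha>\<in>decomps \<gamma>. (\<lambda>j. sum_list (take j \<alpha>)) ` {..<length \<alpha>})"
  have fin: "finite X" by (simp add: X_def finite_decomps)
  have wedge_eq: "wedge (charge_of \<theta>) x \<gamma> =
      (\<Sum>i\<in>UNIV. \<theta> $ i * of_int (x $ i)) * (\<Sum>i\<in>UNIV. of_int (\<gamma> $ i)) -
      (\<Sum>i\<in>UNIV. \<theta> $ i * of_int (\<gamma> $ i)) * (\<Sum>i\<in>UNIV. of_int (x $ i))" for \<theta> x
    by (simp add: wedge_def charge_of_def)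
  have pair: "(\<Sum>i\<in>UNIV. ?\<theta> $ i * of_int (x $ i)) = of_int (B x \<gamma>)" for x
  proof -
    have "additive (\<lambda>x. B x \<gamma>)" using B unfolding skew_form_def by blast
    then have "B x \<gamma> = (\<Sum>i\<in>UNIV. x $ i * B (axis i 1) \<gamma>)"
      using additive_axis_expansion[of "\<lambda>x. B x \<gamma>" x] by simp
    then show ?thesis by (simp add: attractor_stability_def mult.commute)
  qed
  have pos: "0 < (\<Sum>i\<in>UNIV. real_of_int (\<gamma> $ i))"
    using central_charge_Im_pos[OF central_charge_charge_of[of ?\<theta>] \<gamma>] by (simp add: charge_of_def)
  have at_\<theta>: "wedge (charge_of ?\<theta>) x \<gamma> = of_int (B x \<gamma>) * (\<Sum>i\<in>UNIV. of_int (\<gamma> $ i))" for x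
    unfolding wedge_eq pair by (simp add: skew_form_self[OF B])
  have lim: "((\<lambda>\<theta>. wedge (charge_of \<theta>) x \<gamma>) \<longlongrightarrow> wedge (charge_of ?\<theta>) x \<gamma>) (nhds ?\<theta>)" for x
    unfolding wedge_eq by (intro tendsto_intros tendsto_vec_nth filterlim_ident)
  have "\<forall>\<^sub>F \<theta> in nhds ?\<theta>. B x \<gamma> < B y \<gamma> \<longrightarrow> wedge (charge_of \<theta>) x \<gamma> < wedge (charge_of \<theta>) y \<gamma>"
    for x y
  proof (cases "B x \<gamma> < B y \<gamma>")
    case True
    have "0 < wedge (charge_of ?\<theta>) y \<gamma> - wedge (charge_of ?\<theta>) x \<gamma>"
      unfolding at_\<theta> using True pos by (simp add: mult_strict_right_mono)
    from order_tendstoD(1)[OF tendsto_diff[OF lim lim] this] show ?thesis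
      by (rule eventually_mono) simp
  qed simp
  then have "\<forall>\<^sub>F \<theta> in nhds ?\<theta>. \<forall>x\<in>X. \<forall>y\<in>X. B x \<gamma> < B y \<gamma> \<longrightarrow>
      wedge (charge_of \<theta>) x \<gamma> < wedge (charge_of \<theta>) y \<gamma>"
    by (intro eventually_ball_finite[OF fin] ballI)
  then obtain \<epsilon> where \<epsilon>: "\<epsilon> > 0" "\<And>\<theta>' x y. dist \<theta>' ?\<theta> < \<epsilon> \<Longrightarrow> x \<in> X \<Longrightarrow> y \<in> X \<Longrightarrow> B x \<gamma> < B y \<gamma> \<Longrightarrow>
      wedge (charge_of \<theta>') x \<gamma> < wedge (charge_of \<theta>') y \<gamma>"
    unfolding eventually_nhds_metric by blast
  have "sum_list (take j \<alpha>) \<in> X" if "\<alpha> \<in> decomps \<gamma>" "j < length \<alpha>" for \<alpha> j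
    using that by (auto simp: X_def)
  then show ?thesis using \<epsilon> by blast
qed

lemma slope_charge_of_eq:
  assumes "a \<in> SS" "b \<in> SS" "slope (charge_of \<theta>) a = slope (charge_of \<theta>) b"
  shows "(\<Sum>i\<in>UNIV. \<theta> $ i * of_int (a $ i * (\<Sum>j\<in>UNIV. b $ j) - b $ i * (\<Sum>j\<in>UNIV. a $ j))) = 0"
proof -
  have "wedge (charge_of \<theta>) a b = 0"
    using assms slope_eq_iff[OF central_charge_charge_of] by blast
  then have "(\<Sum>i\<in>UNIV. \<theta> $ i * of_int (a $ i)) * (\<Sum>j\<in>UNIV. of_int (b $ j)) -
      (\<Sum>i\<in>UNIV. \<theta> $ i * of_int (b $ i)) * (\<Sum>j\<in>UNIV. of_int (a $ j)) = 0"
    by (simp add: wedge_def charge_of_def)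
  then show ?thesis
    by (simp add: right_diff_distrib sum_subtractf sum_distrib_right mult.assoc)
qed

text \<open>On the curve \<open>s \<mapsto> \<theta> + (s ^ e\<^sub>i)\<^sub>i\<close> with distinct positive exponents \<open>e\<^sub>i\<close>, a coincidence of slopes of two
  non-proportional vectors is a nonzero polynomial equation in \<open>s\<close>. There are countably many such
  equations, each with finitely many solutions, so some arbitrarily small \<open>s\<close> avoids them all.\<close>

lemma exists_generic_near:
  fixes \<theta> :: "real ^ 'r"
  assumes "0 < \<epsilon>"
  shows "\<exists>\<theta>'. dist \<theta>' \<theta> < \<epsilon> \<and> generic (charge_of \<theta>')"
proof -
  obtain f :: "'r \<Rightarrow> nat" where f: "inj f"
    using finite_imp_inj_to_nat_seg[of "UNIV :: 'r set"] by auto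
  define c where "c a b i = a $ i * (\<Sum>j\<in>UNIV. b $ j) - b $ i * (\<Sum>j\<in>UNIV. a $ j)"
    for a b :: "int ^ 'r" and i
  \<comment> \<open>The polynomial in \<open>s\<close> that vanishes if \<open>a\<close> and \<open>b\<close> have the same slope at \<open>\<theta>s s\<close>.\<close>
  define p where "p a b = (\<Sum>i\<in>UNIV. smult (of_int (c a b i)) ([:\<theta> $ i:] + monom 1 (Suc (f i))))"
    for a b
  define \<theta>s where "\<theta>s s = (\<chi> i. \<theta> $ i + s ^ Suc (f i))" for s :: real
  define Bad where "Bad = {(a, b). p a b \<noteq> 0}"
  have poly_p: "poly (p a b) s = (\<Sum>i\<in>UNIV. \<theta>s s $ i * of_int (c a b i))" for a b s
    by (simp add: p_def \<theta>s_def poly_sum poly_monom mult.commute)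
  have "((\<lambda>s. \<theta>s s) \<longlongrightarrow> \<theta>s 0) (nhds 0)"
    unfolding \<theta>s_def by (intro tendsto_vec_lambda tendsto_intros filterlim_ident)
  moreover have "\<theta>s 0 = \<theta>" by (simp add: \<theta>s_def vec_eq_iff)
  ultimately have "\<forall>\<^sub>F s in nhds 0. dist (\<theta>s s) \<theta> < \<epsilon>"
    using assms by (simp add: tendstoD)
  then obtain \<delta> where \<delta>: "\<delta> > 0" "\<And>s. dist s 0 < \<delta> \<Longrightarrow> dist (\<theta>s s) \<theta> < \<epsilon>"
    unfolding eventually_nhds_metric by blast
  have "countable (\<Union>(a, b)\<in>Bad. {s. poly (p a b) s = 0})"
    by (intro countable_UN) (auto simp: Bad_def intro!: countable_finite poly_roots_finite)
  moreover have "uncountable {0<..<\<delta>}"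
    using \<delta>(1) by (simp add: uncountable_open_interval)
  ultimately obtain s where s: "s \<in> {0<..<\<delta>}" "s \<notin> (\<Union>(a, b)\<in>Bad. {s. poly (p a b) s = 0})"
    by (meson countable_subset subsetI)
  have "generic (charge_of (\<theta>s s))"
    unfolding generic_def
  proof (intro ballI impI)
    fix a b :: "int ^ 'r"
    assume ab: "a \<in> SS" "b \<in> SS" and eq: "slope (charge_of (\<theta>s s)) a = slope (charge_of (\<theta>s s)) b"
    have "poly (p a b) s = 0"
      unfolding poly_p c_def using slope_charge_of_eq[OF ab eq] by simp
    then have p0: "p a b = 0" using s(2) by (auto simp: Bad_def)
    \<comment> \<open>By injectivity of \<open>f\<close>, the coefficient of \<open>s ^ Suc (f k)\<close> is \<open>c a b k\<close>.\<close>
    have "c a b k = 0" for k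
    proof -
      have "coeff (p a b) (Suc (f k)) = (\<Sum>i\<in>UNIV. if i = k then of_int (c a b i) else 0)"
        unfolding p_def coeff_sum using f
        by (intro sum.cong refl) (auto simp: coeff_monom inj_eq coeff_pCons)
      then show ?thesis using p0 by (simp add: sum.delta)
    qed
    then have proportional: "a $ i * (\<Sum>j\<in>UNIV. b $ j) = b $ i * (\<Sum>j\<in>UNIV. a $ j)" for i
      by (simp add: c_def)
    have "(\<Sum>j\<in>UNIV. b $ j) \<noteq> 0"
      using total_pos[OF ab(2)] by (simp add: total_def)
    then have "(of_int (\<Sum>j\<in>UNIV. b $ j) :: rat) \<noteq> 0" by (simp only: of_int_eq_0_iff not_False_eq_True)
    then have "of_int (a $ i) = of_int (\<Sum>j\<in>UNIV. a $ j) / of_int (\<Sum>j\<in>UNIV. b $ j) * (of_int (b $ i) :: rat)" for i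
      using arg_cong[OF proportional[of i], of "of_int :: int \<Rightarrow> rat"]
      by (simp add: field_simps del: of_int_sum)
    then show "\<exists>q :: rat. \<forall>i. of_int (a $ i) = q * of_int (b $ i)" by blast
  qed
  moreover have "dist (\<theta>s s) \<theta> < \<epsilon>" using s(1) by (intro \<delta>(2)) (auto simp: dist_real_def)
  ultimately show ?thesis by blast
qed

context graded_rat_algebra
begin

lemma act_hn_coll:
  assumes "\<gamma> \<in> SS"
  shows "act smul (hn_coll Z) (stable_inv A Z) \<gamma> = A \<gamma>"
proof -
  have "act smul (hn_coll Z) (stable_inv A Z) \<gamma> =
      (\<Sum>\<alpha>\<in>decomps \<gamma>. if sorted_wrt (\<lambda>a b. slope Z a > slope Z b) \<alpha>
         then prod_list (map (stable_inv A Z) \<alpha>) else 0)"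
    unfolding act_def hn_coll_def by (intro sum.cong) auto
  then show ?thesis
    by (simp add: sum.inter_filter finite_decomps stable_inv_recursion[OF assms, of A Z])
qed

text \<open>The map \<open>C = power_coll (- t) * A\<close> on the right does not depend on \<open>Z\<close>. One has \<open>A = power_coll t * C\<close>;
  Reineke's inversion turns this into \<open>A\<^sub>Z = stable_coll Z t * C\<close>, and taking logarithms gives \<open>g\<^sub>Z\<close>.\<close>

lemma bar_inv_eq_act_g_charge:
  fixes A :: "int ^ 'r \<Rightarrow> 'a"
  assumes Z: "central_charge Z" and \<gamma>: "\<gamma> \<in> SS"
  shows "bar_inv smul A Z \<gamma> = act smul (g_charge Z t) (act smul (power_coll (- t)) A) \<gamma>"
proof -
  let ?C = "act smul (power_coll (- t)) A"
  have ne: "\<alpha> \<noteq> []" "set \<alpha> \<subseteq> SS" if "\<alpha> \<in> decomps \<delta>" for \<alpha> and \<delta> :: "int ^ 'r"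
    using that by (auto simp: decomps_def)
  have A: "A \<delta> = act smul (power_coll t) ?C \<delta>" if "\<delta> \<in> SS" for \<delta>
  proof -
    have "act smul (power_coll t) ?C \<delta> = act smul unit_coll A \<delta>"
      unfolding act_comp by (rule act_cong[OF comp_power_power_uminus refl]) (rule ne)
    then show ?thesis by (simp add: act_unit_coll[OF that])
  qed
  have stable: "stable_inv A Z \<delta> = act smul (stable_coll Z t) ?C \<delta>" if \<delta>: "\<delta> \<in> SS" for \<delta>
  proof -
    have "stable_inv A Z \<delta> = act smul unit_coll (stable_inv A Z) \<delta>"
      by (simp add: act_unit_coll[OF \<delta>])
    also have "\<dots> = act smul (comp_coll (reineke_coll Z) (hn_coll Z)) (stable_inv A Z) \<delta>"
      by (rule act_cong[OF reineke_inversion[OF Z, symmetric] refl]) (fact ne)+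
    also have "\<dots> = act smul (reineke_coll Z) (act smul (power_coll t) ?C) \<delta>"
      unfolding act_comp[symmetric] by (rule act_cong[OF refl]) (metis A act_hn_coll)
    also have "\<dots> = act smul (stable_coll Z t) ?C \<delta>"
      unfolding act_comp[of "reineke_coll Z"] by (rule act_cong[OF comp_reineke_power refl]) (rule ne)
    finally show ?thesis .
  qed
  have "bar_inv smul A Z \<gamma> = act smul (log_coll Z) (act smul (stable_coll Z t) ?C) \<gamma>"
    unfolding bar_inv_def by (rule act_cong[OF refl stable])
  also have "\<dots> = act smul (g_charge Z t) ?C \<gamma>"
    unfolding act_comp[of "log_coll Z"] by (rule act_cong[OF comp_log_stable[OF Z] refl]) (fact ne)+
  finally show ?thesis .
qed

text \<open>Every stability parameter near the attractor point yields the same value, and generic ones exist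
  arbitrarily close to it, so the definite description in \<open>attractor_inv\<close> denotes that value.\<close>

lemma attractor_inv_eq_act_g_attr:
  assumes B: "skew_form B"
    and comm: "\<And>\<gamma> \<gamma>' x y. \<gamma> \<in> NN \<Longrightarrow> \<gamma>' \<in> NN \<Longrightarrow> B \<gamma> \<gamma>' = 0 \<Longrightarrow>
      x \<in> R \<gamma> \<Longrightarrow> y \<in> R \<gamma>' \<Longrightarrow> x * y = y * x"
    and A: "\<And>a. a \<in> SS \<Longrightarrow> A a \<in> R a"
    and \<gamma>: "\<gamma> \<in> SS"
  shows "attractor_inv smul B A \<gamma> = act smul (g_attr B t) (act smul (power_coll (- t)) A) \<gamma>"
    (is "_ = ?x")
proof -
  let ?\<theta> = "attractor_stability B \<gamma>"
  obtain \<epsilon> where \<epsilon>: "\<epsilon> > 0" and near: "\<And>\<theta>' \<alpha> j k. dist \<theta>' ?\<theta> < \<epsilon> \<Longrightarrow> \<alpha> \<in> decomps \<gamma> \<Longrightarrow>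
      j < length \<alpha> \<Longrightarrow> k < length \<alpha> \<Longrightarrow>
      B (sum_list (take j \<alpha>)) \<gamma> < B (sum_list (take k \<alpha>)) \<gamma> \<Longrightarrow>
      wedge (charge_of \<theta>') (sum_list (take j \<alpha>)) \<gamma> < wedge (charge_of \<theta>') (sum_list (take k \<alpha>)) \<gamma>"
    using heights_near_attractor[OF B \<gamma>] by blast
  have value_near: "bar_inv smul A (charge_of \<theta>') \<gamma> = ?x" if "dist \<theta>' ?\<theta> < \<epsilon>" for \<theta>'
    unfolding bar_inv_eq_act_g_charge[OF central_charge_charge_of \<gamma>, of A \<theta>' t]
    using near[OF that] A
    by (intro act_g_charge_near_attractor[OF B central_charge_charge_of comm] act_component) auto
  show ?thesis
    unfolding attractor_inv_def
  proof (rule the_equality)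
    show "\<exists>\<epsilon>>0. \<forall>\<theta>'. dist \<theta>' ?\<theta> < \<epsilon> \<longrightarrow> generic (charge_of \<theta>') \<longrightarrow>
        bar_inv smul A (charge_of \<theta>') \<gamma> = ?x"
      using \<epsilon> value_near by blast
  next
    fix x
    assume "\<exists>\<epsilon>>0. \<forall>\<theta>'. dist \<theta>' ?\<theta> < \<epsilon> \<longrightarrow> generic (charge_of \<theta>') \<longrightarrow>
        bar_inv smul A (charge_of \<theta>') \<gamma> = x"
    then obtain \<epsilon>' where \<epsilon>': "\<epsilon>' > 0" "\<And>\<theta>'. dist \<theta>' ?\<theta> < \<epsilon>' \<Longrightarrow> generic (charge_of \<theta>') \<Longrightarrow>
        bar_inv smul A (charge_of \<theta>') \<gamma> = x" by blast
    obtain \<theta>' where "dist \<theta>' ?\<theta> < min \<epsilon> \<epsilon>'" "generic (charge_of \<theta>')"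
      using exists_generic_near[of "min \<epsilon> \<epsilon>'" ?\<theta>] \<epsilon> \<epsilon>'(1) by auto
    then show "x = ?x" using \<epsilon>'(2)[of \<theta>'] value_near[of \<theta>'] by simp
  qed
qed

end

section \<open>The attractor tree formula\<close>

theorem theorem3p7:
  fixes smul :: "rat \<Rightarrow> 'a :: ring_1 \<Rightarrow> 'a"
    and R :: "int ^ 'r \<Rightarrow> 'a set"
    and B :: "int ^ 'r \<Rightarrow> int ^ 'r \<Rightarrow> int"
    and A :: "int ^ 'r \<Rightarrow> 'a"
    and Z :: "int ^ 'r \<Rightarrow> complex"
    and t :: rat
  assumes "graded_rat_algebra smul R"
    and "skew_form B"
    and "\<And>\<gamma> \<gamma>' x y. \<gamma> \<in> NN \<Longrightarrow> \<gamma>' \<in> NN \<Longrightarrow> B \<gamma> \<gamma>' = 0 \<Longrightarrow> x \<in> R \<gamma> \<Longrightarrow> y \<in> R \<gamma>' \<Longrightarrow> x * y = y * x"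
    and "\<And>\<gamma>. \<gamma> \<in> SS \<Longrightarrow> A \<gamma> \<in> R \<gamma>"
    and "central_charge Z"
  shows "\<forall>\<gamma>\<in>SS. bar_inv smul A Z \<gamma> = act smul (F_coll B Z t) (attractor_inv smul B A) \<gamma>"
proof
  interpret graded_rat_algebra smul R by fact
  let ?C = "act smul (power_coll (- t)) A" and ?At = "attractor_inv smul B A"
  let ?h = "tree_inverse (g_attr B t)"
  have ne: "\<alpha> \<noteq> []" if "\<alpha> \<in> decomps \<delta>" for \<alpha> and \<delta> :: "int ^ 'r"
    using that by (simp add: decomps_def)
  have attr: "?At \<delta> = act smul (g_attr B t) ?C \<delta>" if "\<delta> \<in> SS" for \<delta>
    by (rule attractor_inv_eq_act_g_attr[OF assms(2-4) that])
  \<comment> \<open>\<open>?h\<close> is a right inverse of \<open>g\<^sub>*\<close>; injectivity of the action of \<open>g\<^sub>*\<close> makes it act as a left inverse.\<close>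
  have C: "?C \<delta> = act smul ?h ?At \<delta>" if "\<delta> \<in> SS" for \<delta>
  proof (rule act_unitriangular_inj[OF _ _ that])
    show "g_attr B t [\<delta>] = 1" for \<delta> by (rule g_attr_single)
    show "act smul (g_attr B t) ?C \<delta> = act smul (g_attr B t) (act smul ?h ?At) \<delta>" if "\<delta> \<in> SS" for \<delta>
    proof -
      have "act smul (g_attr B t) (act smul ?h ?At) \<delta> = act smul unit_coll ?At \<delta>"
        unfolding act_comp by (rule act_cong[OF comp_tree_inverse[of "g_attr B t", OF g_attr_single] refl]) (rule ne)
      then show ?thesis using attr[OF that] by (simp add: act_unit_coll[OF that])
    qed
  qed
  fix \<gamma> :: "int ^ 'r" assume \<gamma>: "\<gamma> \<in> SS"
  have "bar_inv smul A Z \<gamma> = act smul (g_charge Z t) ?C \<gamma>"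
    by (rule bar_inv_eq_act_g_charge[OF assms(5) \<gamma>])
  also have "\<dots> = act smul (g_charge Z t) (act smul ?h ?At) \<gamma>"
    by (rule act_cong[OF refl C])
  also have "\<dots> = act smul (F_coll B Z t) ?At \<gamma>"
    unfolding act_comp by (rule act_cong[OF comp_g_charge_tree_inverse refl]) (rule ne)
  finally show "bar_inv smul A Z \<gamma> = act smul (F_coll B Z t) ?At \<gamma>" .
qed

end
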